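(* For any non-trivial matrix $\mathsf{M}$ in $\mathsf{matr}$, we have $\mathsf{Ari}\Rightarrow_{\mathsf{reg}}\mathsf{M}$; that is, every regular category with $\mathsf{Ari}$-closed relations (i.e., every regular arithmetical category) has $\mathsf{M}$-closed relations.
   Context: Regular categories. A category is regular if it is finitely complete, has coequalisers of kernel pairs, and regular epimorphisms are stable under pullbacks. Matrices. For integers $n,k>0$ and $m\geqslant 0$, $\mathsf{matr}(n,m,k)$ is the set of matrices with $n$ rows and $m+1$ columns with entries in the set of variables $\{x_1,\dots,x_k\}$; $\mathsf{matr}$ is the union of all these sets. The last column is called the right column and the $m$ first columns are the left columns. A row-wise interpretation of $\mathsf{M}\in\mathsf{matr}(n,m,k)$ of type $(A_1,\dots,A_n)$ (where the $A_i$ are sets) is a matrix obtained from $\mathsf{M}$ by applying, for each $i$, a function $f_i\colon\{x_1,\dots,x_k\}\to A_i$ to all entries of the $i$-th row (including the entry in the right column). Factorisation. For morphisms $f,g$ with the same codomain in a category, $f\sqsubset g$ means that $f$ factors through $g$. Matrix property. A finitely complete category $\mathbb{C}$ has $\mathsf{M}$-closed relations (or satisfies the matrix property $\mathsf{M}$), for $\mathsf{M}\in\mathsf{matr}(n,m,k)$, if for all objects $X_1,\dots,X_n,S$, every monomorphism $r\colon R\rightarrowtail X_1\times\cdots\times X_n$ and every row-wise interpretation of $\mathsf{M}$ of type $(\hom(S,X_1),\dots,\hom(S,X_n))$ with left columns $c_1,\dots,c_m$ and right column $y$ (viewed as morphisms $S\to X_1\times\cdots\times X_n$): if $c_l\sqsubset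 r$ for every $l\in\{1,\dots,m\}$, then $y\sqsubset r$. Implication. For $\mathsf{M},\mathsf{N}\in\mathsf{matr}$ (possibly of different sizes), $\mathsf{M}\Rightarrow_{\mathsf{reg}}\mathsf{N}$ means that every regular category with $\mathsf{M}$-closed relations has $\mathsf{N}$-closed relations. Triviality. A matrix $\mathsf{M}\in\mathsf{matr}$ is trivial if every finitely complete category with $\mathsf{M}$-closed relations is a preorder; otherwise it is non-trivial. The arithmetical matrix: $$\mathsf{Ari}=\left[\begin{array}{ccc|c} x_1&x_2&x_2&x_1\\ x_2&x_2&x_1&x_1\\ x_1&x_2&x_1&x_1\end{array}\right].$$ A finitely complete category is called arithmetical if it has $\mathsf{Ari}$-closed relations. *)

theory Defs
  imports "Jordan_Normal_Form.Matrix"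
begin

section \<open>Categories\<close>

text \<open>\<open>Comp C g f\<close> is \<open>g\<close> after \<open>f\<close>. Nothing is required of \<open>Dom\<close>, \<open>Cod\<close>, \<open>Ident\<close>
  and \<open>Comp\<close> outside the objects, the arrows and the composable pairs of \<open>C\<close>.\<close>

record ('o, 'a) cat =
  Obj :: "'o set"
  Arr :: "'a set"
  Dom :: "'a \<Rightarrow> 'o"
  Cod :: "'a \<Rightarrow> 'o"
  Ident :: "'o \<Rightarrow> 'a"
  Comp :: "'a \<Rightarrow> 'a \<Rightarrow> 'a"

definition Hom :: "('o, 'a) cat \<Rightarrow> 'o \<Rightarrow> 'o \<Rightarrow> 'a set" where
  "Hom C X Y = {f \<in> Arr C. Dom C f = X \<and> Cod C f = Y}"

locale category =
  fixes C :: "('o, 'a) cat"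
  assumes Dom_in_Obj: "f \<in> Arr C \<Longrightarrow> Dom C f \<in> Obj C"
    and Cod_in_Obj: "f \<in> Arr C \<Longrightarrow> Cod C f \<in> Obj C"
    and Ident_in_Hom: "X \<in> Obj C \<Longrightarrow> Ident C X \<in> Hom C X X"
    and Comp_in_Hom: "f \<in> Hom C X Y \<Longrightarrow> g \<in> Hom C Y Z \<Longrightarrow> Comp C g f \<in> Hom C X Z"
    and Comp_assoc: "f \<in> Hom C W X \<Longrightarrow> g \<in> Hom C X Y \<Longrightarrow> h \<in> Hom C Y Z \<Longrightarrow>
      Comp C h (Comp C g f) = Comp C (Comp C h g) f"
    and Comp_Ident_right: "f \<in> Hom C X Y \<Longrightarrow> Comp C f (Ident C X) = f"
    and Comp_Ident_left: "f \<in> Hom C X Y \<Longrightarrow> Comp C (Ident C Y) f = f"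

definition preorder_category :: "('o, 'a) cat \<Rightarrow> bool" where
  "preorder_category C \<longleftrightarrow>
     category C \<and> (\<forall>X \<in> Obj C. \<forall>Y \<in> Obj C. \<forall>f \<in> Hom C X Y. \<forall>g \<in> Hom C X Y. f = g)"

definition monomorphism :: "('o, 'a) cat \<Rightarrow> 'a \<Rightarrow> bool" where
  "monomorphism C r \<longleftrightarrow> r \<in> Arr C \<and>
     (\<forall>W \<in> Obj C. \<forall>u \<in> Hom C W (Dom C r). \<forall>v \<in> Hom C W (Dom C r).
        Comp C r u = Comp C r v \<longrightarrow> u = v)"

definition factors_through :: "('o, 'a) cat \<Rightarrow> 'a \<Rightarrow> 'a \<Rightarrow> bool" where
  "factors_through C f g \<longleftrightarrow> f \<in> Arr C \<and> g \<in> Arr C \<and> Cod C f = Cod C g \<and>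
     (\<exists>h \<in> Hom C (Dom C f) (Dom C g). f = Comp C g h)"


section \<open>Limits and regular categories\<close>

definition is_functor ::
  "('i, 'j) cat \<Rightarrow> ('o, 'a) cat \<Rightarrow> ('i \<Rightarrow> 'o) \<Rightarrow> ('j \<Rightarrow> 'a) \<Rightarrow> bool" where
  "is_functor J C Fo Fa \<longleftrightarrow>
     (\<forall>i \<in> Obj J. Fo i \<in> Obj C) \<and>
     (\<forall>a \<in> Arr J. Fa a \<in> Hom C (Fo (Dom J a)) (Fo (Cod J a))) \<and>
     (\<forall>i \<in> Obj J. Fa (Ident J i) = Ident C (Fo i)) \<and>
     (\<forall>a \<in> Arr J. \<forall>b \<in> Arr J. Cod J a = Dom J b \<longrightarrow>
        Fa (Comp J b a) = Comp C (Fa b) (Fa a))"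

definition is_cone ::
  "('i, 'j) cat \<Rightarrow> ('o, 'a) cat \<Rightarrow> ('i \<Rightarrow> 'o) \<Rightarrow> ('j \<Rightarrow> 'a) \<Rightarrow> 'o \<Rightarrow> ('i \<Rightarrow> 'a) \<Rightarrow> bool" where
  "is_cone J C Fo Fa L p \<longleftrightarrow>
     L \<in> Obj C \<and> (\<forall>i \<in> Obj J. p i \<in> Hom C L (Fo i)) \<and>
     (\<forall>a \<in> Arr J. Comp C (Fa a) (p (Dom J a)) = p (Cod J a))"

definition is_limit ::
  "('i, 'j) cat \<Rightarrow> ('o, 'a) cat \<Rightarrow> ('i \<Rightarrow> 'o) \<Rightarrow> ('j \<Rightarrow> 'a) \<Rightarrow> 'o \<Rightarrow> ('i \<Rightarrow> 'a) \<Rightarrow> bool" where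
  "is_limit J C Fo Fa L p \<longleftrightarrow>
     is_cone J C Fo Fa L p \<and>
     (\<forall>W q. is_cone J C Fo Fa W q \<longrightarrow>
        (\<exists>!u. u \<in> Hom C W L \<and> (\<forall>i \<in> Obj J. Comp C (p i) u = q i)))"

text \<open>Every finite category is isomorphic to one whose objects and arrows are natural numbers,
  so these index categories give all finite limits.\<close>

definition finitely_complete :: "('o, 'a) cat \<Rightarrow> bool" where
  "finitely_complete C \<longleftrightarrow> category C \<and>
     (\<forall>(J :: (nat, nat) cat) Fo Fa.
        category J \<and> finite (Obj J) \<and> finite (Arr J) \<and> is_functor J C Fo Fa \<longrightarrow>
        (\<exists>L p. is_limit J C Fo Fa L p))"

definition is_product :: "('o, 'a) cat \<Rightarrow> nat \<Rightarrow> (nat \<Rightarrow> 'o) \<Rightarrow> 'o \<Rightarrow> (nat \<Rightarrow> 'a) \<Rightarrow> bool" where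
  "is_product C n X P \<pi> \<longleftrightarrow>
     P \<in> Obj C \<and> (\<forall>i<n. \<pi> i \<in> Hom C P (X i)) \<and>
     (\<forall>S \<in> Obj C. \<forall>g. (\<forall>i<n. g i \<in> Hom C S (X i)) \<longrightarrow>
        (\<exists>!u. u \<in> Hom C S P \<and> (\<forall>i<n. Comp C (\<pi> i) u = g i)))"

text \<open>The morphism \<open>S \<rightarrow> P\<close> with components \<open>g 0, \<dots>, g (n - 1)\<close>, where \<open>P\<close> is a product with
  projections \<open>\<pi>\<close>.\<close>

definition tuple ::
  "('o, 'a) cat \<Rightarrow> nat \<Rightarrow> 'o \<Rightarrow> (nat \<Rightarrow> 'a) \<Rightarrow> 'o \<Rightarrow> (nat \<Rightarrow> 'a) \<Rightarrow> 'a" where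
  "tuple C n P \<pi> S g = (THE u. u \<in> Hom C S P \<and> (\<forall>i<n. Comp C (\<pi> i) u = g i))"

definition is_pullback :: "('o, 'a) cat \<Rightarrow> 'a \<Rightarrow> 'a \<Rightarrow> 'o \<Rightarrow> 'a \<Rightarrow> 'a \<Rightarrow> bool" where
  "is_pullback C f g P p q \<longleftrightarrow>
     f \<in> Arr C \<and> g \<in> Arr C \<and> Cod C f = Cod C g \<and>
     P \<in> Obj C \<and> p \<in> Hom C P (Dom C f) \<and> q \<in> Hom C P (Dom C g) \<and>
     Comp C f p = Comp C g q \<and>
     (\<forall>W \<in> Obj C. \<forall>s \<in> Hom C W (Dom C f). \<forall>t \<in> Hom C W (Dom C g).
        Comp C f s = Comp C g t \<longrightarrow>
        (\<exists>!u. u \<in> Hom C W P \<and> Comp C p u = s \<and> Comp C q u = t))"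

definition is_kernel_pair :: "('o, 'a) cat \<Rightarrow> 'a \<Rightarrow> 'o \<Rightarrow> 'a \<Rightarrow> 'a \<Rightarrow> bool" where
  "is_kernel_pair C f P p q \<longleftrightarrow> is_pullback C f f P p q"

definition is_coequaliser :: "('o, 'a) cat \<Rightarrow> 'a \<Rightarrow> 'a \<Rightarrow> 'a \<Rightarrow> bool" where
  "is_coequaliser C f g e \<longleftrightarrow>
     f \<in> Arr C \<and> g \<in> Arr C \<and> Dom C f = Dom C g \<and> Cod C f = Cod C g \<and>
     e \<in> Arr C \<and> Dom C e = Cod C f \<and> Comp C e f = Comp C e g \<and>
     (\<forall>Z \<in> Obj C. \<forall>h \<in> Hom C (Cod C f) Z. Comp C h f = Comp C h g \<longrightarrow>
        (\<exists>!u. u \<in> Hom C (Cod C e) Z \<and> Comp C u e = h))"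

definition regular_epi :: "('o, 'a) cat \<Rightarrow> 'a \<Rightarrow> bool" where
  "regular_epi C e \<longleftrightarrow> (\<exists>f g. is_coequaliser C f g e)"

definition regular_category :: "('o, 'a) cat \<Rightarrow> bool" where
  "regular_category C \<longleftrightarrow>
     finitely_complete C \<and>
     (\<forall>f P p q. is_kernel_pair C f P p q \<longrightarrow> (\<exists>e. is_coequaliser C p q e)) \<and>
     (\<forall>f g P p q. is_pullback C f g P p q \<and> regular_epi C f \<longrightarrow> regular_epi C q)"


section \<open>Matrix properties\<close>

text \<open>The variable \<open>x\<^sub>i\<close> is represented by its index \<open>i\<close>. Rows and columns are numbered from
  \<open>0\<close>, so the left columns are the columns \<open>l < m\<close> and the right column is the column \<open>m\<close>.\<close>

definition matr :: "nat \<Rightarrow> nat \<Rightarrow> nat \<Rightarrow> nat mat set" where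
  "matr n m k = {M. 0 < n \<and> 0 < k \<and> M \<in> carrier_mat n (m + 1) \<and> elements_mat M \<subseteq> {1..k}}"

text \<open>A row-wise interpretation is given by the functions \<open>f i\<close>; its column \<open>l\<close>, viewed as a
  morphism into the product, is the tuple of the \<open>f i (M $$ (i, l))\<close>. The quantification over
  \<open>P\<close> and \<open>\<pi>\<close> covers every choice of the product of the \<open>X i\<close>.\<close>

definition has_closed_relations ::
  "('o, 'a) cat \<Rightarrow> nat \<Rightarrow> nat \<Rightarrow> nat \<Rightarrow> nat mat \<Rightarrow> bool" where
  "has_closed_relations C n m k M \<longleftrightarrow>
     (\<forall>X S P \<pi> r f.
        (\<forall>i<n. X i \<in> Obj C) \<and> S \<in> Obj C \<and> is_product C n X P \<pi> \<and>
        monomorphism C r \<and> Cod C r = P \<and>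
        (\<forall>i<n. f i \<in> {1..k} \<rightarrow> Hom C S (X i)) \<longrightarrow>
        (\<forall>l<m. factors_through C (tuple C n P \<pi> S (\<lambda>i. f i (M $$ (i, l)))) r) \<longrightarrow>
        factors_through C (tuple C n P \<pi> S (\<lambda>i. f i (M $$ (i, m)))) r)"

text \<open>A formula cannot quantify over types, so the types of the objects and of the arrows of the
  categories considered are given by the first argument. A matrix is non-trivial if it is not
  \<open>trivial_matrix\<close> for some choice of these types; in a theorem that assumes
  \<open>\<not> trivial_matrix TYPE(('p, 'b) cat) n m k M\<close>, with \<open>'p\<close> and \<open>'b\<close> occurring nowhere else,
  these type variables express that existential.\<close>

definition trivial_matrix ::
  "('o, 'a) cat itself \<Rightarrow> nat \<Rightarrow> nat \<Rightarrow> nat \<Rightarrow> nat mat \<Rightarrow> bool" where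
  "trivial_matrix T n m k M \<longleftrightarrow>
     (\<forall>C :: ('o, 'a) cat.
        finitely_complete C \<and> has_closed_relations C n m k M \<longrightarrow> preorder_category C)"

definition Ari :: "nat mat" where
  "Ari = mat_of_rows_list 4
     [[1, 2, 2, 1],
      [2, 2, 1, 1],
      [1, 2, 1, 1]]"

definition arithmetical :: "('o, 'a) cat \<Rightarrow> bool" where
  "arithmetical C \<longleftrightarrow> finitely_complete C \<and> has_closed_relations C 3 3 2 Ari"

end

theory Submission
  imports Defs
begin

text \<open>A finitely complete category that is not a preorder contains two distinct arrows
  \<open>a, b : S \<rightarrow> Z\<close>, which can be used as the elements of a two-element set. Interpreting a
  non-trivial matrix in them shows that every right entry occurs among the left entries of its
  row, and that the right entries of two rows lie in the same component of the bipartite graph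
  whose edges are the pairs of left entries of these rows. In an arithmetical category all
  relations are difunctional, so the second property puts every two components of the right
  column into the corresponding binary image of \<open>R\<close>; since arithmeticity also yields the
  majority property, the Baker--Pixley argument, which needs images and hence regularity, puts
  the whole right column into \<open>R\<close>.\<close>

section \<open>Jointly monic families and finite limits\<close>

text \<open>A relation is given by its components instead of a monomorphism into a chosen product.
  The index set is arbitrary, so a selection of rows is handled without renumbering.\<close>

definition jointly_monic :: "('o, 'a) cat \<Rightarrow> nat set \<Rightarrow> (nat \<Rightarrow> 'o) \<Rightarrow> 'o \<Rightarrow> (nat \<Rightarrow> 'a) \<Rightarrow> bool" where
  "jointly_monic C I X W r \<longleftrightarrow>
     W \<in> Obj C \<and> (\<forall>i\<in>I. r i \<in> Hom C W (X i)) \<and>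
     (\<forall>V \<in> Obj C. \<forall>u \<in> Hom C V W. \<forall>v \<in> Hom C V W.
        (\<forall>i\<in>I. Comp C (r i) u = Comp C (r i) v) \<longrightarrow> u = v)"

context category
begin

abbreviation comp (infixr "\<cdot>" 70) where "g \<cdot> f \<equiv> Comp C g f"

lemma Hom_Obj: "f \<in> Hom C X Y \<Longrightarrow> X \<in> Obj C" "f \<in> Hom C X Y \<Longrightarrow> Y \<in> Obj C"
  using Dom_in_Obj Cod_in_Obj unfolding Hom_def by auto

lemma jointly_monicD:
  assumes "jointly_monic C I X W r" "u \<in> Hom C V W" "v \<in> Hom C V W"
    and "\<And>i. i \<in> I \<Longrightarrow> r i \<cdot> u = r i \<cdot> v"
  shows "u = v"
  using assms Hom_Obj unfolding jointly_monic_def by blast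

text \<open>Separates the uniqueness half of the universal property, which is joint monicity of the
  projections, from the existence half; arrows into a product can then be compared by
  \<open>jointly_monicD\<close>.\<close>

lemma is_product_iff:
  "is_product C n X P \<pi> \<longleftrightarrow> jointly_monic C {..<n} X P \<pi> \<and>
     (\<forall>S \<in> Obj C. \<forall>g. (\<forall>i<n. g i \<in> Hom C S (X i)) \<longrightarrow> (\<exists>u \<in> Hom C S P. \<forall>i<n. \<pi> i \<cdot> u = g i))"
  (is "?L \<longleftrightarrow> ?R")
proof
  assume L: ?L
  then have P: "P \<in> Obj C" "\<And>i. i < n \<Longrightarrow> \<pi> i \<in> Hom C P (X i)"
    and U: "\<And>S g. S \<in> Obj C \<Longrightarrow> (\<And>i. i < n \<Longrightarrow> g i \<in> Hom C S (X i)) \<Longrightarrow>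
        \<exists>!u. u \<in> Hom C S P \<and> (\<forall>i<n. \<pi> i \<cdot> u = g i)"
    unfolding is_product_def by simp_all
  have "u = v" if "V \<in> Obj C" "u \<in> Hom C V P" "v \<in> Hom C V P"
    "\<And>i. i < n \<Longrightarrow> \<pi> i \<cdot> u = \<pi> i \<cdot> v" for V u v
    using U[of V "\<lambda>i. \<pi> i \<cdot> v"] that P Comp_in_Hom by blast
  moreover have "\<exists>u \<in> Hom C S P. \<forall>i<n. \<pi> i \<cdot> u = g i"
    if "S \<in> Obj C" "\<And>i. i < n \<Longrightarrow> g i \<in> Hom C S (X i)" for S g
    using U[of S g] that by blast
  ultimately show ?R
    unfolding jointly_monic_def using P by auto
next
  assume R: ?R
  have "\<exists>!u. u \<in> Hom C S P \<and> (\<forall>i<n. \<pi> i \<cdot> u = g i)"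
    if g: "S \<in> Obj C" "\<forall>i<n. g i \<in> Hom C S (X i)" for S g
  proof -
    obtain u where u: "u \<in> Hom C S P" "\<forall>i<n. \<pi> i \<cdot> u = g i"
      using R g by blast
    show ?thesis
    proof (rule ex1I[of _ u])
      show "v = u" if "v \<in> Hom C S P \<and> (\<forall>i<n. \<pi> i \<cdot> v = g i)" for v
        by (rule jointly_monicD[of "{..<n}" X P \<pi> v S u]) (use R u that in auto)
    qed (use u in simp)
  qed
  then show ?L
    using R unfolding is_product_def jointly_monic_def by auto
qed

lemma tuple:
  assumes "is_product C n X P \<pi>" "S \<in> Obj C" "\<And>i. i < n \<Longrightarrow> g i \<in> Hom C S (X i)"
  shows "tuple C n P \<pi> S g \<in> Hom C S P" "i < n \<Longrightarrow> \<pi> i \<cdot> tuple C n P \<pi> S g = g i"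
proof -
  have "\<exists>!u. u \<in> Hom C S P \<and> (\<forall>i<n. \<pi> i \<cdot> u = g i)"
    using assms unfolding is_product_def by blast
  then have "tuple C n P \<pi> S g \<in> Hom C S P \<and> (\<forall>i<n. \<pi> i \<cdot> tuple C n P \<pi> S g = g i)"
    unfolding tuple_def by (rule theI')
  then show "tuple C n P \<pi> S g \<in> Hom C S P" "i < n \<Longrightarrow> \<pi> i \<cdot> tuple C n P \<pi> S g = g i"
    by auto
qed

lemma jointly_monic_mediating:
  assumes r: "jointly_monic C I X W r" and h: "h \<in> Hom C W P"
    and \<pi>: "\<And>i. i \<in> I \<Longrightarrow> \<pi> i \<in> Hom C P (X i)" "\<And>i. i \<in> I \<Longrightarrow> \<pi> i \<cdot> h = r i"
  shows "monomorphism C h"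
  unfolding monomorphism_def
proof (intro conjI ballI impI)
  fix V u v
  assume "u \<in> Hom C V (Dom C h)" "v \<in> Hom C V (Dom C h)" and eq: "h \<cdot> u = h \<cdot> v"
  then have uv: "u \<in> Hom C V W" "v \<in> Hom C V W"
    using h unfolding Hom_def by auto
  show "u = v"
    using r uv
  proof (rule jointly_monicD)
    show "r i \<cdot> u = r i \<cdot> v" if "i \<in> I" for i
      using \<pi>[OF that] eq Comp_assoc[OF uv(1) h] Comp_assoc[OF uv(2) h] by metis
  qed
qed (use h in \<open>auto simp: Hom_def\<close>)

text \<open>Passes from monomorphisms into a product to jointly monic families: a column lies in the
  relation when a single generalised element \<open>z\<close> of \<open>W\<close> has its entries as
  components. \<open>closed_relations_span\<close> is the converse passage.\<close>

lemma closed_relationsI: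
  assumes M: "\<And>i l. i < n \<Longrightarrow> l \<le> m \<Longrightarrow> M $$ (i, l) \<in> {1..k}"
    and span: "\<And>X W r S f. jointly_monic C {..<n} X W r \<Longrightarrow> S \<in> Obj C \<Longrightarrow>
      (\<And>i. i < n \<Longrightarrow> f i \<in> {1..k} \<rightarrow> Hom C S (X i)) \<Longrightarrow>
      (\<And>l. l < m \<Longrightarrow> \<exists>z \<in> Hom C S W. \<forall>i<n. r i \<cdot> z = f i (M $$ (i, l))) \<Longrightarrow>
      \<exists>z \<in> Hom C S W. \<forall>i<n. r i \<cdot> z = f i (M $$ (i, m))"
  shows "has_closed_relations C n m k M"
  unfolding has_closed_relations_def
proof (intro allI impI; elim conjE)
  fix X S P \<pi> h f
  assume S: "S \<in> Obj C" and P: "is_product C n X P \<pi>" and mono: "monomorphism C h"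
    and hP: "Cod C h = P" and f: "\<forall>i<n. f i \<in> {1..k} \<rightarrow> Hom C S (X i)"
    and left: "\<forall>l<m. factors_through C (tuple C n P \<pi> S (\<lambda>i. f i (M $$ (i, l)))) h"
  define W where "W = Dom C h"
  have hA: "h \<in> Arr C" using mono unfolding monomorphism_def by blast
  then have h: "h \<in> Hom C W P" using hP unfolding W_def Hom_def by blast
  have jP: "jointly_monic C {..<n} X P \<pi>" using P unfolding is_product_iff by blast
  then have \<pi>: "\<And>i. i < n \<Longrightarrow> \<pi> i \<in> Hom C P (X i)" unfolding jointly_monic_def by blast
  have ph: "(\<pi> i \<cdot> h) \<cdot> u = \<pi> i \<cdot> h \<cdot> u" if "i < n" "u \<in> Hom C V W" for i u V
    using Comp_assoc[OF that(2) h \<pi>[OF that(1)]] by simp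
  have c: "tuple C n P \<pi> S (\<lambda>i. f i (M $$ (i, l))) \<in> Hom C S P"
    "\<And>i. i < n \<Longrightarrow> \<pi> i \<cdot> tuple C n P \<pi> S (\<lambda>i. f i (M $$ (i, l))) = f i (M $$ (i, l))"
    if l: "l \<le> m" for l
  proof -
    have g: "f i (M $$ (i, l)) \<in> Hom C S (X i)" if "i < n" for i
      using f M[OF that l] that by blast
    show "tuple C n P \<pi> S (\<lambda>i. f i (M $$ (i, l))) \<in> Hom C S P"
      using tuple(1)[OF P S g] .
    show "\<pi> i \<cdot> tuple C n P \<pi> S (\<lambda>i. f i (M $$ (i, l))) = f i (M $$ (i, l))" if "i < n" for i
      using tuple(2)[OF P S g that] .
  qed
  \<comment> \<open>The projections detect equality of arrows into \<open>P\<close>, and the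
    monomorphism \<open>h\<close> reflects it to arrows into \<open>W\<close>.\<close>
  have "jointly_monic C {..<n} X W (\<lambda>i. \<pi> i \<cdot> h)"
    unfolding jointly_monic_def
  proof (intro conjI ballI impI)
    show "W \<in> Obj C" using Hom_Obj(1)[OF h] .
    show "\<pi> i \<cdot> h \<in> Hom C W (X i)" if "i \<in> {..<n}" for i
      using Comp_in_Hom[OF h \<pi>] that by simp
    fix V u v
    assume V: "V \<in> Obj C" and uv: "u \<in> Hom C V W" "v \<in> Hom C V W"
      and eq: "\<forall>i\<in>{..<n}. (\<pi> i \<cdot> h) \<cdot> u = (\<pi> i \<cdot> h) \<cdot> v"
    have "h \<cdot> u = h \<cdot> v"
      by (rule jointly_monicD[OF jP Comp_in_Hom[OF uv(1) h] Comp_in_Hom[OF uv(2) h]])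
        (use eq ph uv in auto)
    then show "u = v" using mono V uv unfolding monomorphism_def W_def by blast
  qed
  then have "\<exists>z \<in> Hom C S W. \<forall>i<n. (\<pi> i \<cdot> h) \<cdot> z = f i (M $$ (i, m))"
  proof (rule span[OF _ S])
    show "f i \<in> {1..k} \<rightarrow> Hom C S (X i)" if "i < n" for i using f that by blast
    show "\<exists>z \<in> Hom C S W. \<forall>i<n. (\<pi> i \<cdot> h) \<cdot> z = f i (M $$ (i, l))" if l: "l < m" for l
    proof -
      have "Dom C (tuple C n P \<pi> S (\<lambda>i. f i (M $$ (i, l)))) = S"
        using c(1)[of l] l unfolding Hom_def by simp
      then obtain z where "z \<in> Hom C S W" "tuple C n P \<pi> S (\<lambda>i. f i (M $$ (i, l))) = h \<cdot> z"
        using left l unfolding factors_through_def W_def by metis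
      then show ?thesis using ph c(2)[of l] l by (metis less_imp_le)
    qed
  qed
  then obtain z where z: "z \<in> Hom C S W" "\<forall>i<n. (\<pi> i \<cdot> h) \<cdot> z = f i (M $$ (i, m))" by blast
  have "tuple C n P \<pi> S (\<lambda>i. f i (M $$ (i, m))) = h \<cdot> z"
    by (rule jointly_monicD[OF jP c(1) Comp_in_Hom[OF z(1) h]]) (use c(2) ph z in auto)
  moreover have "tuple C n P \<pi> S (\<lambda>i. f i (M $$ (i, m))) \<in> Hom C S P" using c(1) by blast
  ultimately show "factors_through C (tuple C n P \<pi> S (\<lambda>i. f i (M $$ (i, m)))) h"
    using z(1) hA hP unfolding factors_through_def Hom_def W_def by auto
qed

end

section \<open>Products and pullbacks as limits over explicit finite index categories\<close>

locale finitely_complete_category = category C for C :: "('o, 'a) cat" +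
  assumes fin_complete: "finitely_complete C"
begin

lemma ex_product:
  assumes "finite I" and X: "\<And>i. i \<in> I \<Longrightarrow> X i \<in> Obj C"
  obtains P \<pi> where "jointly_monic C I X P \<pi>"
    "\<And>S g. S \<in> Obj C \<Longrightarrow> (\<And>i. i \<in> I \<Longrightarrow> g i \<in> Hom C S (X i)) \<Longrightarrow>
       \<exists>u \<in> Hom C S P. \<forall>i\<in>I. \<pi> i \<cdot> u = g i"
proof -
  \<comment> \<open>The discrete category on \<open>I\<close>: every index is its own identity, so
    composable arrows are equal.\<close>
  define J :: "(nat, nat) cat" where
    "J = \<lparr>Obj = I, Arr = I, Dom = id, Cod = id, Ident = id, Comp = \<lambda>b a. a\<rparr>"
  have J: "category J" "finite (Obj J)" "finite (Arr J)"
    by (unfold_locales) (auto simp: J_def Hom_def assms)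
  have F: "is_functor J C X (\<lambda>i. Ident C (X i))"
    using X Ident_in_Hom Comp_Ident_left
    by (fastforce simp: J_def is_functor_def)
  obtain P \<pi> where lim: "is_limit J C X (\<lambda>i. Ident C (X i)) P \<pi>"
    using fin_complete J F unfolding finitely_complete_def by blast
  have cone: "is_cone J C X (\<lambda>i. Ident C (X i)) S g \<longleftrightarrow>
      S \<in> Obj C \<and> (\<forall>i\<in>I. g i \<in> Hom C S (X i))" for S g
    using Comp_Ident_left by (auto simp: is_cone_def J_def)
  have P: "P \<in> Obj C" "\<And>i. i \<in> I \<Longrightarrow> \<pi> i \<in> Hom C P (X i)"
    using lim cone unfolding is_limit_def by auto
  have U: "\<exists>!u. u \<in> Hom C S P \<and> (\<forall>i\<in>I. \<pi> i \<cdot> u = g i)"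
    if "S \<in> Obj C" "\<And>i. i \<in> I \<Longrightarrow> g i \<in> Hom C S (X i)" for S g
  proof -
    have "is_cone J C X (\<lambda>i. Ident C (X i)) S g"
      using that cone by blast
    moreover have "Obj J = I" by (simp add: J_def)
    ultimately show ?thesis
      using lim unfolding is_limit_def by simp
  qed
  show thesis
  proof (rule that)
    have "u = v" if "V \<in> Obj C" "u \<in> Hom C V P" "v \<in> Hom C V P"
      "\<forall>i\<in>I. \<pi> i \<cdot> u = \<pi> i \<cdot> v" for V u v
      using U[of V "\<lambda>i. \<pi> i \<cdot> v"] that P Comp_in_Hom by blast
    then show "jointly_monic C I X P \<pi>"
      unfolding jointly_monic_def using P by blast
    show "\<exists>u \<in> Hom C S P. \<forall>i\<in>I. \<pi> i \<cdot> u = g i"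
      if "S \<in> Obj C" "\<And>i. i \<in> I \<Longrightarrow> g i \<in> Hom C S (X i)" for S g
      using U[of S g] that by blast
  qed
qed

lemma ex_is_product:
  assumes "\<And>i. i < n \<Longrightarrow> X i \<in> Obj C"
  obtains P \<pi> where "is_product C n X P \<pi>"
proof -
  obtain P \<pi> where P: "jointly_monic C {..<n} X P \<pi>"
    "\<And>S g. S \<in> Obj C \<Longrightarrow> (\<And>i. i \<in> {..<n} \<Longrightarrow> g i \<in> Hom C S (X i)) \<Longrightarrow>
       \<exists>u \<in> Hom C S P. \<forall>i\<in>{..<n}. \<pi> i \<cdot> u = g i"
    by (rule ex_product[of "{..<n}" X]) (use assms in auto)
  have "is_product C n X P \<pi>"
    unfolding is_product_iff using P by (metis lessThan_iff)
  then show thesis by (rule that)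
qed

lemma ex_pullback:
  assumes f: "f \<in> Hom C X Z" and g: "g \<in> Hom C Y Z"
  obtains P p q where "is_pullback C f g P p q" "p \<in> Hom C P X" "q \<in> Hom C P Y" "f \<cdot> p = g \<cdot> q"
proof -
  \<comment> \<open>The cospan: objects \<open>0\<close> and \<open>1\<close> are the feet and
    \<open>2\<close> is the apex; arrows below \<open>3\<close> are identities, \<open>3\<close>
    goes from \<open>0\<close> to \<open>2\<close> and \<open>4\<close> from \<open>1\<close> to
    \<open>2\<close>. In a composable pair at least one arrow is an identity, which
    \<open>Comp\<close> discards.\<close>
  define J :: "(nat, nat) cat" where
    "J = \<lparr>Obj = {0, 1, 2}, Arr = {0, 1, 2, 3, 4},
      Dom = (\<lambda>a. if a < 3 then a else a - 3), Cod = (\<lambda>a. if a < 3 then a else 2),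
      Ident = id, Comp = \<lambda>b a. if b < 3 then a else b\<rparr>"
  define Fo where "Fo i = (if i = (0::nat) then X else if i = 1 then Y else Z)" for i
  define Fa where "Fa a = (if a = 3 then f else if a = 4 then g else Ident C (Fo a))" for a
  have J: "category J" "finite (Obj J)" "finite (Arr J)"
    by (unfold_locales) (auto simp: J_def Hom_def split: if_splits)
  have obj: "X \<in> Obj C" "Y \<in> Obj C" "Z \<in> Obj C"
    using f g Hom_Obj by auto
  have F: "is_functor J C Fo Fa"
    using obj f g Ident_in_Hom Comp_Ident_left[OF Ident_in_Hom]
      Comp_Ident_left[OF f] Comp_Ident_left[OF g] Comp_Ident_right[OF f] Comp_Ident_right[OF g]
    by (auto simp: is_functor_def J_def Fo_def Fa_def)
  obtain P \<pi> where lim: "is_limit J C Fo Fa P \<pi>"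
    using fin_complete J F unfolding finitely_complete_def by blast
  have cone: "is_cone J C Fo Fa S h \<longleftrightarrow>
      S \<in> Obj C \<and> h 0 \<in> Hom C S X \<and> h 1 \<in> Hom C S Y \<and> h 2 \<in> Hom C S Z \<and>
      f \<cdot> h 0 = h 2 \<and> g \<cdot> h 1 = h 2" for S h
    using Comp_Ident_left by (auto simp: is_cone_def J_def Fo_def Fa_def)
  have P: "P \<in> Obj C" "\<pi> 0 \<in> Hom C P X" "\<pi> 1 \<in> Hom C P Y" "\<pi> 2 \<in> Hom C P Z"
    "f \<cdot> \<pi> 0 = \<pi> 2" "g \<cdot> \<pi> 1 = \<pi> 2"
    using lim cone[of P \<pi>] unfolding is_limit_def by blast+
  have D: "Dom C f = X" "Dom C g = Y" "Cod C f = Z" "Cod C g = Z" "f \<in> Arr C" "g \<in> Arr C"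
    using f g unfolding Hom_def by auto
  have "\<exists>!u. u \<in> Hom C W P \<and> \<pi> 0 \<cdot> u = s \<and> \<pi> 1 \<cdot> u = t"
    if s: "s \<in> Hom C W X" and t: "t \<in> Hom C W Y" and eq: "f \<cdot> s = g \<cdot> t" for W s t
  proof -
    \<comment> \<open>The leg of a cone at the apex is forced to be the common composite, so cones
      are commuting pairs \<open>s\<close>, \<open>t\<close>.\<close>
    define h where "h i = (if i = (0::nat) then s else if i = 1 then t else f \<cdot> s)" for i
    have fs: "f \<cdot> s \<in> Hom C W Z" using Comp_in_Hom s f by blast
    have "is_cone J C Fo Fa W h"
      unfolding cone using s t eq fs Hom_Obj by (auto simp: h_def)
    then have "\<exists>!u. u \<in> Hom C W P \<and> (\<forall>i\<in>Obj J. \<pi> i \<cdot> u = h i)"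
      using lim unfolding is_limit_def by blast
    moreover have "(\<forall>i\<in>Obj J. \<pi> i \<cdot> u = h i) \<longleftrightarrow> \<pi> 0 \<cdot> u = s \<and> \<pi> 1 \<cdot> u = t"
      if "u \<in> Hom C W P" for u
      using Comp_assoc[OF that P(2) f] P(5) by (auto simp: J_def h_def)
    ultimately show ?thesis by metis
  qed
  then have "is_pullback C f g P (\<pi> 0) (\<pi> 1)"
    unfolding is_pullback_def using P D by auto
  then show thesis using that P by metis
qed

text \<open>The family \<open>r\<close> induces a monomorphism \<open>h\<close> into a product, and
  comparing components shows that a column factors through \<open>h\<close> exactly when some
  \<open>z\<close> into \<open>W\<close> realises it.\<close>

lemma closed_relations_span:
  assumes cl: "has_closed_relations C n m k M"
    and M: "\<And>i l. i < n \<Longrightarrow> l \<le> m \<Longrightarrow> M $$ (i, l) \<in> {1..k}"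
    and r: "jointly_monic C {..<n} X W r" and S: "S \<in> Obj C"
    and f: "\<And>i. i < n \<Longrightarrow> f i \<in> {1..k} \<rightarrow> Hom C S (X i)"
    and left: "\<And>l. l < m \<Longrightarrow> \<exists>z \<in> Hom C S W. \<forall>i<n. r i \<cdot> z = f i (M $$ (i, l))"
  shows "\<exists>z \<in> Hom C S W. \<forall>i<n. r i \<cdot> z = f i (M $$ (i, m))"
proof -
  have W: "W \<in> Obj C" and rH: "\<And>i. i < n \<Longrightarrow> r i \<in> Hom C W (X i)"
    using r unfolding jointly_monic_def by auto
  then have X: "\<And>i. i < n \<Longrightarrow> X i \<in> Obj C"
    using Hom_Obj by blast
  then obtain P \<pi> where P: "is_product C n X P \<pi>"
    using ex_is_product by blast
  then have jP: "jointly_monic C {..<n} X P \<pi>" and \<pi>: "\<And>i. i < n \<Longrightarrow> \<pi> i \<in> Hom C P (X i)"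
    unfolding is_product_iff jointly_monic_def by auto
  define h where "h = tuple C n P \<pi> W r"
  have h: "h \<in> Hom C W P" "\<And>i. i < n \<Longrightarrow> \<pi> i \<cdot> h = r i"
    unfolding h_def using tuple[OF P W rH] by auto
  have hA: "h \<in> Arr C" "Dom C h = W" "Cod C h = P" using h(1) unfolding Hom_def by auto
  have mono: "monomorphism C h"
    by (rule jointly_monic_mediating[OF r h(1)]) (use \<pi> h in auto)
  define c where "c l = tuple C n P \<pi> S (\<lambda>i. f i (M $$ (i, l)))" for l
  have fM: "f i (M $$ (i, l)) \<in> Hom C S (X i)" if "i < n" "l \<le> m" for i l
    using f M that by blast
  have c: "c l \<in> Hom C S P" "\<And>i. i < n \<Longrightarrow> \<pi> i \<cdot> c l = f i (M $$ (i, l))" if "l \<le> m" for l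
    unfolding c_def using tuple[OF P S, of "\<lambda>i. f i (M $$ (i, l))"] fM that by auto
  have fact: "factors_through C (c l) h \<longleftrightarrow>
      (\<exists>z \<in> Hom C S W. \<forall>i<n. r i \<cdot> z = f i (M $$ (i, l)))" if l: "l \<le> m" for l
  proof -
    have cA: "c l \<in> Arr C" "Dom C (c l) = S" "Cod C (c l) = P"
      using c(1)[OF l] unfolding Hom_def by auto
    have "c l = h \<cdot> z \<longleftrightarrow> (\<forall>i<n. r i \<cdot> z = f i (M $$ (i, l)))" if z: "z \<in> Hom C S W" for z
    proof -
      have *: "\<pi> i \<cdot> h \<cdot> z = r i \<cdot> z" if "i < n" for i
        using Comp_assoc[OF z h(1) \<pi>] h(2) that by simp
      show ?thesis
      proof
        assume "c l = h \<cdot> z"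
        then show "\<forall>i<n. r i \<cdot> z = f i (M $$ (i, l))"
          using * c(2)[OF l] by metis
      next
        assume "\<forall>i<n. r i \<cdot> z = f i (M $$ (i, l))"
        then show "c l = h \<cdot> z"
          using jointly_monicD[OF jP c(1)[OF l] Comp_in_Hom[OF z h(1)]] * c(2)[OF l] by simp
      qed
    qed
    then show ?thesis
      unfolding factors_through_def using cA hA by auto
  qed
  have "\<forall>l<m. factors_through C (c l) h"
    using fact left by auto
  then have "factors_through C (c m) h"
    using cl X S P mono hA(3) f unfolding has_closed_relations_def c_def by blast
  then show ?thesis using fact by blast
qed

end


lemma finitely_complete_categoryI: "finitely_complete C \<Longrightarrow> finitely_complete_category C"
  by (simp add: finitely_complete_category_def finitely_complete_category_axioms_def
      finitely_complete_def)

section \<open>Covers and images in regular categories\<close>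

context category
begin

lemma regular_epiE:
  assumes "regular_epi C e" "e \<in> Hom C T S"
  obtains R p q where "p \<in> Hom C R T" "q \<in> Hom C R T" "e \<cdot> p = e \<cdot> q"
    "\<forall>Z. \<forall>h \<in> Hom C T Z. h \<cdot> p = h \<cdot> q \<longrightarrow> (\<exists>!u. u \<in> Hom C S Z \<and> u \<cdot> e = h)"
proof -
  obtain p q where c: "is_coequaliser C p q e"
    using assms unfolding regular_epi_def by blast
  have T: "Dom C e = T" "Cod C e = S" using assms unfolding Hom_def by auto
  have p: "p \<in> Hom C (Dom C p) T" "q \<in> Hom C (Dom C p) T"
    using c T unfolding is_coequaliser_def Hom_def by auto
  show thesis
  proof (rule that[OF p])
    show "e \<cdot> p = e \<cdot> q" using c unfolding is_coequaliser_def by blast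
    have "Cod C p = T" using p unfolding Hom_def by blast
    then show "\<forall>Z. \<forall>h \<in> Hom C T Z. h \<cdot> p = h \<cdot> q \<longrightarrow> (\<exists>!u. u \<in> Hom C S Z \<and> u \<cdot> e = h)"
      using c T Hom_Obj(2) unfolding is_coequaliser_def by fast
  qed
qed

text \<open>Both arrows solve the same factorisation problem, posed by \<open>v \<cdot> e\<close>,
  which coequalises the pair that \<open>e\<close> is a coequaliser of.\<close>

lemma regular_epi_cancel:
  assumes "regular_epi C e" "e \<in> Hom C T S" "u \<in> Hom C S Z" "v \<in> Hom C S Z" "u \<cdot> e = v \<cdot> e"
  shows "u = v"
proof -
  obtain R p q where pq: "p \<in> Hom C R T" "q \<in> Hom C R T" "e \<cdot> p = e \<cdot> q"
    and U: "\<forall>Z. \<forall>h \<in> Hom C T Z. h \<cdot> p = h \<cdot> q \<longrightarrow> (\<exists>!u. u \<in> Hom C S Z \<and> u \<cdot> e = h)"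
    by (rule regular_epiE[OF assms(1,2)])
  have "(v \<cdot> e) \<cdot> p = (v \<cdot> e) \<cdot> q"
    using Comp_assoc[OF pq(1) assms(2,4)] Comp_assoc[OF pq(2) assms(2,4)] pq(3) by simp
  then show ?thesis
    using bspec[OF spec[OF U] Comp_in_Hom[OF assms(2,4)]] assms(3-5) by blast
qed

text \<open>Since \<open>e\<close> identifies \<open>p\<close> and \<open>q\<close>, so does every
  \<open>r i \<cdot> z\<close>; joint monicity then makes \<open>z\<close> itself identify them, and
  \<open>z\<close> factors through \<open>e\<close>. Membership in a relation thus descends along
  \<open>e\<close>.\<close>

lemma regular_epi_diagonal:
  assumes e: "regular_epi C e" "e \<in> Hom C T S"
    and r: "jointly_monic C I X W r" and z: "z \<in> Hom C T W"
    and y: "\<And>i. i \<in> I \<Longrightarrow> y i \<in> Hom C S (X i)" "\<And>i. i \<in> I \<Longrightarrow> r i \<cdot> z = y i \<cdot> e"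
  shows "\<exists>w \<in> Hom C S W. \<forall>i\<in>I. r i \<cdot> w = y i"
proof -
  obtain R p q where pq: "p \<in> Hom C R T" "q \<in> Hom C R T" "e \<cdot> p = e \<cdot> q"
    and U: "\<forall>Z. \<forall>h \<in> Hom C T Z. h \<cdot> p = h \<cdot> q \<longrightarrow> (\<exists>!u. u \<in> Hom C S Z \<and> u \<cdot> e = h)"
    by (rule regular_epiE[OF e])
  have rH: "r i \<in> Hom C W (X i)" if "i \<in> I" for i
    using r that unfolding jointly_monic_def by blast
  have "r i \<cdot> z \<cdot> p = r i \<cdot> z \<cdot> q" if i: "i \<in> I" for i
    using Comp_assoc[OF pq(1) z rH[OF i]] Comp_assoc[OF pq(2) z rH[OF i]] y(2)[OF i] pq(3)
      Comp_assoc[OF pq(1) e(2) y(1)[OF i]] Comp_assoc[OF pq(2) e(2) y(1)[OF i]] by simp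
  then have "z \<cdot> p = z \<cdot> q"
    by (rule jointly_monicD[OF r Comp_in_Hom[OF pq(1) z] Comp_in_Hom[OF pq(2) z]])
  then obtain w where w: "w \<in> Hom C S W" "w \<cdot> e = z"
    using U z by blast
  have "r i \<cdot> w = y i" if i: "i \<in> I" for i
    by (rule regular_epi_cancel[OF e Comp_in_Hom[OF w(1) rH[OF i]] y(1)[OF i]])
      (use Comp_assoc[OF e(2) w(1) rH[OF i]] w(2) y(2)[OF i] in simp)
  then show ?thesis using w(1) by blast
qed

text \<open>Composites of regular epimorphisms are taken as covers, which avoids proving that regular
  epimorphisms are closed under composition.\<close>

inductive cover :: "'o \<Rightarrow> 'o \<Rightarrow> 'a \<Rightarrow> bool" where
  Ident: "S \<in> Obj C \<Longrightarrow> cover S S (Ident C S)"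
| Comp: "cover T S e \<Longrightarrow> regular_epi C e' \<Longrightarrow> e' \<in> Hom C T' T \<Longrightarrow> cover T' S (e \<cdot> e')"

lemma cover_Hom: "cover T S e \<Longrightarrow> e \<in> Hom C T S"
  by (induction rule: cover.induct) (auto intro: Ident_in_Hom Comp_in_Hom)

lemma cover_regular_epi: "regular_epi C e \<Longrightarrow> e \<in> Hom C T S \<Longrightarrow> cover T S e"
  using cover.Comp[OF cover.Ident] Comp_Ident_left Hom_Obj(2) by metis

lemma cover_trans: "cover U T e' \<Longrightarrow> cover T S e \<Longrightarrow> cover U S (e \<cdot> e')"
proof (induction rule: cover.induct)
  case (Ident T)
  then show ?case using Comp_Ident_right cover_Hom by metis
next
  case (Comp T1 T e1 e2 U)
  then show ?case
    using cover.Comp[OF Comp.IH[OF Comp.prems] Comp.hyps(2,3)] cover_Hom Comp_assoc by metis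
qed

lemma cover_cancel:
  "cover T S e \<Longrightarrow> u \<in> Hom C S Z \<Longrightarrow> v \<in> Hom C S Z \<Longrightarrow> u \<cdot> e = v \<cdot> e \<Longrightarrow> u = v"
proof (induction rule: cover.induct)
  case (Ident S)
  then show ?case using Comp_Ident_right by metis
next
  case (Comp T S e e' T')
  note e = cover_Hom[OF Comp.hyps(1)]
  have "(u \<cdot> e) \<cdot> e' = (v \<cdot> e) \<cdot> e'"
    using Comp.prems Comp_assoc[OF Comp.hyps(3) e] by metis
  then have "u \<cdot> e = v \<cdot> e"
    using regular_epi_cancel[OF Comp.hyps(2,3)] Comp_in_Hom[OF e] Comp.prems by blast
  then show ?case using Comp.IH Comp.prems by blast
qed

lemma cover_diagonal:
  assumes "cover T S e" and r: "jointly_monic C I X W r" and "z \<in> Hom C T W"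
    and "\<And>i. i \<in> I \<Longrightarrow> y i \<in> Hom C S (X i)" "\<And>i. i \<in> I \<Longrightarrow> r i \<cdot> z = y i \<cdot> e"
  shows "\<exists>w \<in> Hom C S W. \<forall>i\<in>I. r i \<cdot> w = y i"
  using assms(1,3-)
proof (induction arbitrary: z rule: cover.induct)
  case (Ident S)
  then show ?case using Comp_Ident_right by metis
next
  case (Comp T S e e' T')
  note e = cover_Hom[OF Comp.hyps(1)]
  \<comment> \<open>Descend along the last factor \<open>e'\<close> first, with the family
    \<open>y i \<cdot> e\<close> as target; the induction hypothesis descends along the
    rest.\<close>
  have "\<exists>w \<in> Hom C T W. \<forall>i\<in>I. r i \<cdot> w = y i \<cdot> e"
    by (rule regular_epi_diagonal[OF Comp.hyps(2,3) r Comp.prems(1)])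
      (use Comp.prems Comp_in_Hom[OF e] Comp_assoc[OF Comp.hyps(3) e] in metis)+
  then obtain w where "w \<in> Hom C T W" "\<forall>i\<in>I. r i \<cdot> w = y i \<cdot> e"
    by blast
  then show ?case using Comp.IH Comp.prems(2) by blast
qed

end

section \<open>Stability of covers and image factorisations\<close>

locale regular_cat = finitely_complete_category +
  assumes regular: "regular_category C"
begin

text \<open>The regular epimorphisms composing a cover are pulled back one after another. In effect
  every generalised element of \<open>S\<close> lifts to \<open>T\<close> locally, that is, after a
  cover of its domain.\<close>

lemma cover_lift:
  "cover T S e \<Longrightarrow> u \<in> Hom C W S \<Longrightarrow>
    \<exists>V e' v. cover V W e' \<and> v \<in> Hom C V T \<and> e \<cdot> v = u \<cdot> e'"
proof (induction rule: cover.induct)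
  case (Ident S)
  then show ?case
    using cover.Ident[OF Hom_Obj(1)] Comp_Ident_left Comp_Ident_right by metis
next
  case (Comp T S e e1 T')
  note e = cover_Hom[OF Comp.hyps(1)]
  obtain V e' v where V: "cover V W e'" "v \<in> Hom C V T" "e \<cdot> v = u \<cdot> e'"
    using Comp by blast
  obtain V' p q where pb: "is_pullback C e1 v V' p q" and pq: "p \<in> Hom C V' T'" "q \<in> Hom C V' V"
    "e1 \<cdot> p = v \<cdot> q"
    using ex_pullback[OF Comp.hyps(3) V(2)] by metis
  have "regular_epi C q"
    using regular pb Comp.hyps(2) unfolding regular_category_def by blast
  then have "cover V' W (e' \<cdot> q)"
    using cover.Comp[OF V(1) _ pq(2)] by blast
  moreover have "(e \<cdot> e1) \<cdot> p = u \<cdot> e' \<cdot> q"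
    using Comp_assoc[OF pq(1) Comp.hyps(3) e] pq(3) Comp_assoc[OF pq(2) V(2) e] V(3)
      Comp_assoc[OF pq(2) cover_Hom[OF V(1)] Comp.prems] by simp
  ultimately show ?case using pq(1) by blast
qed

text \<open>Lifting \<open>e'\<close> through \<open>e\<close> covers \<open>T'\<close>, and
  composing with \<open>e'\<close> gives a cover of \<open>S\<close> that refines both.\<close>

lemma common_cover:
  assumes "cover T S e" "cover T' S e'"
  obtains U d a b where "cover U S d" "a \<in> Hom C U T" "b \<in> Hom C U T'" "e \<cdot> a = d" "e' \<cdot> b = d"
proof -
  obtain U b a where "cover U T' b" "a \<in> Hom C U T" "e \<cdot> a = e' \<cdot> b"
    using cover_lift[OF assms(1) cover_Hom[OF assms(2)]] by metis
  then show thesis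
    using that[of U "e' \<cdot> b" a b] cover_trans assms(2) cover_Hom by metis
qed

text \<open>The arrow \<open>f\<close> from \<open>W\<close> into the product of the
  \<open>X i\<close> is factored through the coequaliser \<open>e\<close> of its kernel pair. That
  the remaining family is jointly monic is checked on local lifts to \<open>W\<close>.\<close>

lemma image_factorisation:
  assumes "finite I" and W: "W \<in> Obj C" and r: "\<And>i. i \<in> I \<Longrightarrow> r i \<in> Hom C W (X i)"
  obtains E e m where "cover W E e" "jointly_monic C I X E m" "\<forall>i\<in>I. m i \<cdot> e = r i"
proof -
  obtain P \<pi> where P: "jointly_monic C I X P \<pi>"
    and lift: "\<And>S g. S \<in> Obj C \<Longrightarrow> (\<And>i. i \<in> I \<Longrightarrow> g i \<in> Hom C S (X i)) \<Longrightarrow>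
       \<exists>u \<in> Hom C S P. \<forall>i\<in>I. \<pi> i \<cdot> u = g i"
    by (rule ex_product[OF assms(1), of X]) (use r Hom_Obj in blast)+
  have \<pi>: "\<pi> i \<in> Hom C P (X i)" if "i \<in> I" for i
    using P that unfolding jointly_monic_def by blast
  obtain f where f: "f \<in> Hom C W P" "\<And>i. i \<in> I \<Longrightarrow> \<pi> i \<cdot> f = r i"
    using lift[OF W r] by blast
  obtain K p q where pb: "is_pullback C f f K p q"
    and pq: "p \<in> Hom C K W" "q \<in> Hom C K W" "f \<cdot> p = f \<cdot> q"
    using ex_pullback[OF f(1) f(1)] by metis
  obtain e where e: "is_coequaliser C p q e"
    using regular pb unfolding regular_category_def is_kernel_pair_def by blast
  define E where "E = Cod C e"
  have eH: "e \<in> Hom C W E"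
    using e pq(1) unfolding is_coequaliser_def E_def Hom_def by auto
  have reg: "regular_epi C e" using e unfolding regular_epi_def by blast
  have cov: "cover W E e" by (rule cover_regular_epi[OF reg eH])
  have epq: "e \<cdot> p = e \<cdot> q" using e unfolding is_coequaliser_def by blast
  have "Cod C p = W" using pq(1) unfolding Hom_def by blast
  \<comment> \<open>\<open>f\<close> identifies its own kernel pair and therefore factors through
    the coequaliser.\<close>
  then obtain g where g: "g \<in> Hom C E P" "g \<cdot> e = f"
    using e f(1) pq(3) Hom_Obj(2)[OF f(1)] unfolding is_coequaliser_def E_def by metis
  define m where "m i = \<pi> i \<cdot> g" for i
  have m: "m i \<in> Hom C E (X i)" "m i \<cdot> e = r i" if "i \<in> I" for i
    using Comp_in_Hom[OF g(1) \<pi>[OF that]] Comp_assoc[OF eH g(1) \<pi>[OF that]] g(2) f(2)[OF that]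
    unfolding m_def by auto
  have "u = v" if u: "u \<in> Hom C V E" and v: "v \<in> Hom C V E"
    and eq: "\<forall>i\<in>I. m i \<cdot> u = m i \<cdot> v" for V u v
  proof -
    \<comment> \<open>Lift \<open>u\<close> and then \<open>v\<close> through \<open>e\<close>, the
      second over the cover used for the first, so that both lifts live on
      \<open>V2\<close>.\<close>
    obtain V1 c1 a where 1: "cover V1 V c1" "a \<in> Hom C V1 W" "e \<cdot> a = u \<cdot> c1"
      using cover_lift[OF cov u] by metis
    note c1 = cover_Hom[OF 1(1)]
    obtain V2 c2 b where 2: "cover V2 V1 c2" "b \<in> Hom C V2 W" "e \<cdot> b = (v \<cdot> c1) \<cdot> c2"
      using cover_lift[OF cov Comp_in_Hom[OF c1 v]] by metis
    note c2 = cover_Hom[OF 2(1)]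
    define c where "c = c1 \<cdot> c2"
    have c: "cover V2 V c" unfolding c_def by (rule cover_trans[OF 2(1) 1(1)])
    note cH = cover_Hom[OF c]
    define a' where "a' = a \<cdot> c2"
    have a': "a' \<in> Hom C V2 W" unfolding a'_def by (rule Comp_in_Hom[OF c2 1(2)])
    have ea: "e \<cdot> a' = u \<cdot> c"
      unfolding a'_def c_def using Comp_assoc[OF c2 1(2) eH] 1(3) Comp_assoc[OF c2 c1 u] by simp
    have eb: "e \<cdot> b = v \<cdot> c"
      unfolding c_def using 2(3) Comp_assoc[OF c2 c1 v] by simp
    have "f \<cdot> a' = f \<cdot> b"
    proof (rule jointly_monicD[OF P Comp_in_Hom[OF a' f(1)] Comp_in_Hom[OF 2(2) f(1)]])
      fix i assume i: "i \<in> I"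
      have *: "\<pi> i \<cdot> f \<cdot> x = m i \<cdot> e \<cdot> x" if "x \<in> Hom C V2 W" for x
        using Comp_assoc[OF that f(1) \<pi>[OF i]] f(2)[OF i] m(2)[OF i]
          Comp_assoc[OF that eH m(1)[OF i]] by simp
      have "m i \<cdot> u \<cdot> c = m i \<cdot> v \<cdot> c"
        using Comp_assoc[OF cH u m(1)[OF i]] Comp_assoc[OF cH v m(1)[OF i]] eq i by simp
      then show "\<pi> i \<cdot> f \<cdot> a' = \<pi> i \<cdot> f \<cdot> b"
        using *[OF a'] *[OF 2(2)] ea eb by simp
    qed
    moreover have "Dom C f = W" using f(1) unfolding Hom_def by blast
    \<comment> \<open>The two lifts have equal composites with \<open>f\<close>, so they form a
      generalised element of the kernel pair, which \<open>e\<close> identifies; the cover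
      \<open>c\<close> is then cancelled.\<close>
    ultimately obtain w where w: "w \<in> Hom C V2 K" "p \<cdot> w = a'" "q \<cdot> w = b"
      using pb a' 2(2) Hom_Obj(1)[OF a'] unfolding is_pullback_def by metis
    have "e \<cdot> a' = e \<cdot> b"
      using Comp_assoc[OF w(1) pq(1) eH] Comp_assoc[OF w(1) pq(2) eH] w epq by simp
    then show "u = v"
      using cover_cancel[OF c u v] ea eb by simp
  qed
  then have "jointly_monic C I X E m"
    unfolding jointly_monic_def using m(1) Hom_Obj(2)[OF eH] by blast
  then show thesis using that[OF cov] m(2) by blast
qed

end

section \<open>Arithmetical categories\<close>

locale arithmetical_cat = finitely_complete_category +
  assumes arith: "has_closed_relations C 3 3 2 Ari"
begin

text \<open>The rows of \<open>Ari\<close> are the Pixley identities p x y y = x, p x x y = y and p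
  x y x = x, one for each coordinate; \<open>w\<close> plays the role of p applied to
  \<open>z0\<close>, \<open>z1\<close>, \<open>z2\<close>.\<close>

lemma Ari_ternary:
  assumes r: "jointly_monic C {..<3} X W r"
    and z: "z0 \<in> Hom C S W" "z1 \<in> Hom C S W" "z2 \<in> Hom C S W"
    and eq: "r 0 \<cdot> z1 = r 0 \<cdot> z2" "r 1 \<cdot> z0 = r 1 \<cdot> z1" "r 2 \<cdot> z0 = r 2 \<cdot> z2"
  shows "\<exists>w \<in> Hom C S W. r 0 \<cdot> w = r 0 \<cdot> z0 \<and> r 1 \<cdot> w = r 1 \<cdot> z2 \<and> r 2 \<cdot> w = r 2 \<cdot> z0"
proof -
  \<comment> \<open>The second left column is constantly the variable 2, so \<open>b\<close> is read
    off \<open>z1\<close>. The variable 1 occurs in rows 0 and 2 of the first left column and in row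
    1 of the third, whence \<open>z0\<close> and \<open>z2\<close>.\<close>
  define a where "a i = (if i = (1::nat) then r i \<cdot> z2 else r i \<cdot> z0)" for i
  define b where "b i = r i \<cdot> z1" for i
  define f where "f i x = (if x = (1::nat) then a i else b i)" for i x
  have rH: "r i \<in> Hom C W (X i)" if "i < 3" for i
    using r that unfolding jointly_monic_def by blast
  have three: "i = 0 \<or> i = 1 \<or> i = 2" if "i < 3" for i :: nat
    using that by auto
  have Ari: "Ari $$ (i, l) = [[1, 2, 2, 1], [2, 2, 1, 1], [1, 2, 1, 1]] ! i ! l" if "i < 3" "l < 4" for i l
    using that unfolding Ari_def by (simp add: mat_of_rows_list_def)
  have "\<exists>w \<in> Hom C S W. \<forall>i<3. r i \<cdot> w = f i (Ari $$ (i, 3))"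
  proof (rule closed_relations_span[OF arith _ r Hom_Obj(1)[OF z(1)]])
    show "Ari $$ (i, l) \<in> {1..2}" if "i < 3" "l \<le> 3" for i l
    proof -
      have "l = 0 \<or> l = 1 \<or> l = 2 \<or> l = 3" using that by auto
      then show ?thesis using three[OF that(1)] Ari[OF that(1), of l] by auto
    qed
    show "f i \<in> {1..2} \<rightarrow> Hom C S (X i)" if "i < 3" for i
      using Comp_in_Hom[OF _ rH[OF that]] z by (auto simp: f_def a_def b_def)
    show "\<exists>z \<in> Hom C S W. \<forall>i<3. r i \<cdot> z = f i (Ari $$ (i, l))" if "l < 3" for l
    proof -
      have "\<forall>i<3. r i \<cdot> [z0, z1, z2] ! l = f i (Ari $$ (i, l))"
        using three[OF that] Ari[of _ l] eq by (auto simp: f_def a_def b_def dest!: three)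
      moreover have "[z0, z1, z2] ! l \<in> Hom C S W"
        using three[OF that] z by auto
      ultimately show ?thesis by blast
    qed
  qed
  then obtain w where w: "w \<in> Hom C S W" "\<And>i. i < 3 \<Longrightarrow> r i \<cdot> w = f i (Ari $$ (i, 3))"
    by blast
  have "f 0 (Ari $$ (0, 3)) = r 0 \<cdot> z0" "f 1 (Ari $$ (1, 3)) = r 1 \<cdot> z2" "f 2 (Ari $$ (2, 3)) = r 2 \<cdot> z0"
    using Ari[of 0 3] Ari[of 1 3] Ari[of 2 3] by (simp_all add: f_def a_def)
  then show ?thesis
    using w(1) w(2)[of 0] w(2)[of 1] w(2)[of 2] by auto
qed

text \<open>Extends the ternary case to any finite number of coordinates: those governed by the same
  Pixley identity are bundled into one product, leaving a relation with three components.\<close>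

lemma Ari_family:
  assumes fin: "finite I" and r: "jointly_monic C I X W r"
    and z: "z0 \<in> Hom C S W" "z1 \<in> Hom C S W" "z2 \<in> Hom C S W"
    and t: "\<And>i. i \<in> I \<Longrightarrow> r i \<cdot> z1 = r i \<cdot> z2 \<and> t i = r i \<cdot> z0 \<or>
      r i \<cdot> z0 = r i \<cdot> z1 \<and> t i = r i \<cdot> z2 \<or> r i \<cdot> z0 = r i \<cdot> z2 \<and> t i = r i \<cdot> z0"
  shows "\<exists>w \<in> Hom C S W. \<forall>i\<in>I. r i \<cdot> w = t i"
proof -
  have W: "W \<in> Obj C" and rH: "\<And>i. i \<in> I \<Longrightarrow> r i \<in> Hom C W (X i)"
    using r unfolding jointly_monic_def by auto
  \<comment> \<open>The blocks may overlap or be empty: \<open>t\<close> prescribes the value in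
    every case, and an empty block has a terminal object as its product.\<close>
  define K where "K j = {i \<in> I. if j = (0::nat) then r i \<cdot> z1 = r i \<cdot> z2 \<and> t i = r i \<cdot> z0
    else if j = 1 then r i \<cdot> z0 = r i \<cdot> z1 \<and> t i = r i \<cdot> z2
    else r i \<cdot> z0 = r i \<cdot> z2 \<and> t i = r i \<cdot> z0}" for j
  have K: "finite (K j)" "K j \<subseteq> I" for j
    using fin unfolding K_def by auto
  have "\<exists>P \<pi> h. jointly_monic C (K j) X P \<pi> \<and> h \<in> Hom C W P \<and> (\<forall>i\<in>K j. \<pi> i \<cdot> h = r i)" for j
  proof -
    obtain P \<pi> where P: "jointly_monic C (K j) X P \<pi>"
      and lift: "\<And>S g. S \<in> Obj C \<Longrightarrow> (\<And>i. i \<in> K j \<Longrightarrow> g i \<in> Hom C S (X i)) \<Longrightarrow>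
         \<exists>u \<in> Hom C S P. \<forall>i\<in>K j. \<pi> i \<cdot> u = g i"
      by (rule ex_product[OF K(1), of j X]) (use rH Hom_Obj K(2) in blast)+
    show ?thesis using P lift[OF W, of r] rH K(2) by blast
  qed
  then obtain P \<pi> h where P: "\<And>j. jointly_monic C (K j) X (P j) (\<pi> j)"
    and h: "\<And>j. h j \<in> Hom C W (P j)" "\<And>i j. i \<in> K j \<Longrightarrow> \<pi> j i \<cdot> h j = r i"
    by metis
  have \<pi>h: "\<pi> j i \<cdot> h j \<cdot> u = r i \<cdot> u" if "i \<in> K j" "u \<in> Hom C V W" for i j u V
  proof -
    have "\<pi> j i \<in> Hom C (P j) (X i)"
      using P that(1) unfolding jointly_monic_def by blast
    then show ?thesis using Comp_assoc[OF that(2) h(1)] h(2)[OF that(1)] by metis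
  qed
  have hI: "h j \<cdot> u = h j \<cdot> v"
    if "u \<in> Hom C V W" "v \<in> Hom C V W" "\<And>i. i \<in> K j \<Longrightarrow> r i \<cdot> u = r i \<cdot> v" for j u v V
    by (rule jointly_monicD[OF P Comp_in_Hom[OF that(1) h(1)] Comp_in_Hom[OF that(2) h(1)]])
      (use \<pi>h that in metis)
  have I: "i \<in> K 0 \<or> i \<in> K 1 \<or> i \<in> K 2" if "i \<in> I" for i
    using t[OF that] that unfolding K_def by auto
  \<comment> \<open>The three blocks cover \<open>I\<close>, so equality in the blocks gives
    equality in all original coordinates.\<close>
  have j: "jointly_monic C {..<3} P W h"
    unfolding jointly_monic_def
  proof (intro conjI ballI impI W h(1))
    fix V u v
    assume uv: "u \<in> Hom C V W" "v \<in> Hom C V W" and eq: "\<forall>j\<in>{..<3}. h j \<cdot> u = h j \<cdot> v"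
    show "u = v"
    proof (rule jointly_monicD[OF r uv])
      fix i assume "i \<in> I"
      then obtain j where "j \<in> {0, 1, 2}" "i \<in> K j" using I[of i] by blast
      moreover from this have "h j \<cdot> u = h j \<cdot> v" using eq by auto
      ultimately show "r i \<cdot> u = r i \<cdot> v" using \<pi>h uv by metis
    qed
  qed
  have "\<exists>w \<in> Hom C S W. h 0 \<cdot> w = h 0 \<cdot> z0 \<and> h 1 \<cdot> w = h 1 \<cdot> z2 \<and> h 2 \<cdot> w = h 2 \<cdot> z0"
    by (rule Ari_ternary[OF j z]; rule hI) (use z in \<open>auto simp: K_def\<close>)
  then obtain w where w: "w \<in> Hom C S W"
    "h 0 \<cdot> w = h 0 \<cdot> z0" "h 1 \<cdot> w = h 1 \<cdot> z2" "h 2 \<cdot> w = h 2 \<cdot> z0" by blast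
  have "r i \<cdot> w = t i" if "i \<in> I" for i
    using I[OF that]
  proof (elim disjE)
    assume i: "i \<in> K 0"
    then have "r i \<cdot> w = r i \<cdot> z0" using \<pi>h[OF i w(1)] \<pi>h[OF i z(1)] w(2) by simp
    then show ?thesis using i unfolding K_def by simp
  next
    assume i: "i \<in> K 1"
    then have "r i \<cdot> w = r i \<cdot> z2" using \<pi>h[OF i w(1)] \<pi>h[OF i z(3)] w(3) by simp
    then show ?thesis using i unfolding K_def by simp
  next
    assume i: "i \<in> K 2"
    then have "r i \<cdot> w = r i \<cdot> z0" using \<pi>h[OF i w(1)] \<pi>h[OF i z(1)] w(4) by simp
    then show ?thesis using i unfolding K_def by simp
  qed
  then show ?thesis using w(1) by blast
qed

text \<open>If \<open>p\<close> is a Pixley operation then \<open>p x (p x y z) z\<close> is a majority operation.\<close>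

lemma majority_family:
  assumes fin: "finite I" and r: "jointly_monic C I X W r"
    and z: "z0 \<in> Hom C S W" "z1 \<in> Hom C S W" "z2 \<in> Hom C S W"
    and t: "\<And>i. i \<in> I \<Longrightarrow> r i \<cdot> z0 = t i \<and> r i \<cdot> z1 = t i \<or>
      r i \<cdot> z0 = t i \<and> r i \<cdot> z2 = t i \<or> r i \<cdot> z1 = t i \<and> r i \<cdot> z2 = t i"
  shows "\<exists>w \<in> Hom C S W. \<forall>i\<in>I. r i \<cdot> w = t i"
proof -
  \<comment> \<open>The value of p at the three coordinates. The hypothesis on \<open>t\<close>
    makes two of them agree, so one of the Pixley identities determines it.\<close>
  define s where "s i = (if r i \<cdot> z1 = r i \<cdot> z2 then r i \<cdot> z0
    else if r i \<cdot> z0 = r i \<cdot> z1 then r i \<cdot> z2 else r i \<cdot> z0)" for i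
  have "\<exists>w \<in> Hom C S W. \<forall>i\<in>I. r i \<cdot> w = s i"
    by (rule Ari_family[OF fin r z]) (use t s_def in metis)
  then obtain z' where z': "z' \<in> Hom C S W" "\<forall>i\<in>I. r i \<cdot> z' = s i" by blast
  show ?thesis
    by (rule Ari_family[OF fin r z(1) z'(1) z(3)]) (use t s_def z'(2) in metis)
qed

text \<open>The Mal'tsev identities p x y y = x and p x x y = y. On two coordinates they complete
  three corners of a rectangle in the relation to the fourth, which is difunctionality.\<close>

lemma difunctional_family:
  assumes fin: "finite I" and r: "jointly_monic C I X W r"
    and z: "z0 \<in> Hom C S W" "z1 \<in> Hom C S W" "z2 \<in> Hom C S W"
    and t: "\<And>i. i \<in> I \<Longrightarrow> r i \<cdot> z1 = r i \<cdot> z2 \<and> t i = r i \<cdot> z0 \<or>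
      r i \<cdot> z0 = r i \<cdot> z1 \<and> t i = r i \<cdot> z2"
  shows "\<exists>w \<in> Hom C S W. \<forall>i\<in>I. r i \<cdot> w = t i"
  by (rule Ari_family[OF fin r z]) (use t in blast)

end

locale regular_arithmetical_cat = regular_cat + arithmetical_cat
begin

text \<open>The Baker--Pixley argument, carried out up to covers.\<close>

lemma two_decomposable:
  fixes I :: "nat set"
  assumes W: "W \<in> Obj C"
    and y: "\<And>i. i \<in> I \<Longrightarrow> y i \<in> Hom C S (X i)"
    and pair: "\<And>i j. i \<in> I \<Longrightarrow> j \<in> I \<Longrightarrow>
      \<exists>T e z. cover T S e \<and> z \<in> Hom C T W \<and> r i \<cdot> z = y i \<cdot> e \<and> r j \<cdot> z = y j \<cdot> e"
    and r: "\<And>i. i \<in> I \<Longrightarrow> r i \<in> Hom C W (X i)"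
    and fin: "finite I" and ne: "I \<noteq> {}"
  shows "\<exists>T e z. cover T S e \<and> z \<in> Hom C T W \<and> (\<forall>i\<in>I. r i \<cdot> z = y i \<cdot> e)"
  using fin ne y r pair
proof (induction "card I" arbitrary: I rule: less_induct)
  case less
  show ?case
  \<comment> \<open>Taking \<open>a = b\<close> is allowed, so singletons belong to this base
    case.\<close>
  proof (cases "\<exists>a b. I = {a, b}")
    case True
    then obtain a b where "I = {a, b}" by blast
    then show ?thesis using less.prems(5)[of a b] by blast
  next
    case False
    obtain a where a: "a \<in> I" using less.prems(2) by blast
    obtain b where b: "b \<in> I" "b \<noteq> a" using a False by blast
    obtain c where c: "c \<in> I" "c \<noteq> a" "c \<noteq> b" using a b False by blast
    \<comment> \<open>Omitting \<open>a\<close>, \<open>b\<close> or \<open>c\<close> gives three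
      local elements, each possibly wrong at one index only; these indices differ, so at every index
      at least two are right.\<close>
    have drop: "\<exists>T e z. cover T S e \<and> z \<in> Hom C T W \<and> (\<forall>i\<in>I - {d}. r i \<cdot> z = y i \<cdot> e)"
      if d: "d \<in> I" "I - {d} \<noteq> {}" for d
      by (rule less.hyps)
        (use less.prems d in \<open>auto intro: card_Diff1_less simp del: card_Diff_singleton card_Diff_insert\<close>)
    obtain T0 e0 z0 where 0: "cover T0 S e0" "z0 \<in> Hom C T0 W" "\<forall>i\<in>I - {a}. r i \<cdot> z0 = y i \<cdot> e0"
      using drop[OF a] b by blast
    obtain T1 e1 z1 where 1: "cover T1 S e1" "z1 \<in> Hom C T1 W" "\<forall>i\<in>I - {b}. r i \<cdot> z1 = y i \<cdot> e1"
      using drop[OF b(1)] a b by blast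
    obtain T2 e2 z2 where 2: "cover T2 S e2" "z2 \<in> Hom C T2 W" "\<forall>i\<in>I - {c}. r i \<cdot> z2 = y i \<cdot> e2"
      using drop[OF c(1)] a c by blast
    \<comment> \<open>Two refinements bring the three local elements to one cover \<open>T\<close>
      of \<open>S\<close>.\<close>
    obtain T3 e3 p q where 3: "cover T3 S e3" "p \<in> Hom C T3 T0" "q \<in> Hom C T3 T1"
      "e0 \<cdot> p = e3" "e1 \<cdot> q = e3"
      by (rule common_cover[OF 0(1) 1(1)])
    obtain T e p' q' where T: "cover T S e" "p' \<in> Hom C T T3" "q' \<in> Hom C T T2"
      "e3 \<cdot> p' = e" "e2 \<cdot> q' = e"
      by (rule common_cover[OF 3(1) 2(1)])
    note eH = cover_Hom[OF T(1)]
    have pp: "p \<cdot> p' \<in> Hom C T T0" "q \<cdot> p' \<in> Hom C T T1" "e0 \<cdot> p \<cdot> p' = e" "e1 \<cdot> q \<cdot> p' = e"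
      using Comp_in_Hom[OF T(2) 3(2)] Comp_in_Hom[OF T(2) 3(3)] 3(4,5) T(4)
        Comp_assoc[OF T(2) 3(2) cover_Hom[OF 0(1)]] Comp_assoc[OF T(2) 3(3) cover_Hom[OF 1(1)]]
      by auto
    \<comment> \<open>The family \<open>r\<close> is not assumed jointly monic on \<open>I\<close>,
      as \<open>majority_family\<close> demands; its image is.\<close>
    obtain E g m where E: "cover W E g" "jointly_monic C I X E m" "\<forall>i\<in>I. m i \<cdot> g = r i"
      by (rule image_factorisation[OF less.prems(1) W less.prems(4)])
    note gH = cover_Hom[OF E(1)]
    have mH: "m i \<in> Hom C E (X i)" if "i \<in> I" for i
      using E(2) that unfolding jointly_monic_def by blast
    have mg: "m i \<cdot> g \<cdot> u = r i \<cdot> u" if "u \<in> Hom C V W" "i \<in> I" for u V i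
      using Comp_assoc[OF that(1) gH mH[OF that(2)]] bspec[OF E(3) that(2)] by simp
    have transport: "\<exists>w \<in> Hom C T E. \<forall>i\<in>I - {d}. m i \<cdot> w = y i \<cdot> e"
      if z: "z \<in> Hom C T' W" "\<forall>i\<in>I - {d}. r i \<cdot> z = y i \<cdot> e'" "e' \<in> Hom C T' S"
        and x: "x \<in> Hom C T T'" "e' \<cdot> x = e" for z T' e' x d
    proof (intro bexI ballI)
      show "g \<cdot> z \<cdot> x \<in> Hom C T E" by (rule Comp_in_Hom[OF Comp_in_Hom[OF x(1) z(1)] gH])
      show "m i \<cdot> g \<cdot> z \<cdot> x = y i \<cdot> e" if i: "i \<in> I - {d}" for i
      proof -
        have iI: "i \<in> I" using i by blast
        have "m i \<cdot> g \<cdot> z \<cdot> x = r i \<cdot> z \<cdot> x"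
          by (rule mg[OF Comp_in_Hom[OF x(1) z(1)] iI])
        also have "\<dots> = (y i \<cdot> e') \<cdot> x"
          using Comp_assoc[OF x(1) z(1) less.prems(4)[OF iI]] z(2) i by simp
        also have "\<dots> = y i \<cdot> e"
          using Comp_assoc[OF x(1) z(3) less.prems(3)[OF iI]] x(2) by simp
        finally show ?thesis .
      qed
    qed
    obtain w0 where w0: "w0 \<in> Hom C T E" "\<forall>i\<in>I - {a}. m i \<cdot> w0 = y i \<cdot> e"
      using transport[OF 0(2,3) cover_Hom[OF 0(1)] pp(1,3)] by blast
    obtain w1 where w1: "w1 \<in> Hom C T E" "\<forall>i\<in>I - {b}. m i \<cdot> w1 = y i \<cdot> e"
      using transport[OF 1(2,3) cover_Hom[OF 1(1)] pp(2,4)] by blast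
    obtain w2 where w2: "w2 \<in> Hom C T E" "\<forall>i\<in>I - {c}. m i \<cdot> w2 = y i \<cdot> e"
      using transport[OF 2(2,3) cover_Hom[OF 2(1)] T(3,5)] by blast
    have "\<exists>w \<in> Hom C T E. \<forall>i\<in>I. m i \<cdot> w = y i \<cdot> e"
      by (rule majority_family[OF less.prems(1) E(2) w0(1) w1(1) w2(1)])
        (use w0(2) w1(2) w2(2) b(2) c(2,3) in blast)
    then obtain w where w: "w \<in> Hom C T E" "\<forall>i\<in>I. m i \<cdot> w = y i \<cdot> e" by blast
    \<comment> \<open>Return from the image to \<open>W\<close>, at the price of a further
      cover.\<close>
    obtain V d v where V: "cover V T d" "v \<in> Hom C V W" "g \<cdot> v = w \<cdot> d"
      using cover_lift[OF E(1) w(1)] by blast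
    have "r i \<cdot> v = y i \<cdot> e \<cdot> d" if i: "i \<in> I" for i
      using mg[OF V(2) i] V(3) Comp_assoc[OF cover_Hom[OF V(1)] w(1) mH[OF i]] w(2) i
        Comp_assoc[OF cover_Hom[OF V(1)] eH less.prems(3)[OF i]] by simp
    then show ?thesis using cover_trans[OF V(1) T(1)] V(2) by blast
  qed
qed

end

section \<open>Non-trivial matrices\<close>

text \<open>The least difunctional relation containing \<open>E\<close>. It relates \<open>a\<close>
  to \<open>b\<close> exactly when a path joins them in the bipartite graph with edge relation
  \<open>E\<close>; arguments on the two sides count as different vertices even if they are
  equal.\<close>

inductive difunctional_closure :: "('a \<Rightarrow> 'b \<Rightarrow> bool) \<Rightarrow> 'a \<Rightarrow> 'b \<Rightarrow> bool" for E where
  base: "E a b \<Longrightarrow> difunctional_closure E a b"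
| step: "difunctional_closure E a b' \<Longrightarrow> difunctional_closure E a' b' \<Longrightarrow>
    difunctional_closure E a' b \<Longrightarrow> difunctional_closure E a b"

abbreviation row_pairs :: "nat \<Rightarrow> 'a mat \<Rightarrow> nat \<Rightarrow> nat \<Rightarrow> 'a \<Rightarrow> 'a \<Rightarrow> bool" where
  "row_pairs m M i j \<equiv> \<lambda>x w. \<exists>l<m. x = M $$ (i, l) \<and> w = M $$ (j, l)"

lemma matr_entry:
  "M \<in> matr n m k \<Longrightarrow> i < n \<Longrightarrow> l \<le> m \<Longrightarrow> M $$ (i, l) \<in> {1..k}"
  unfolding matr_def using elements_matI[of M n "m + 1" i l] by auto

context finitely_complete_category
begin

lemma section_monic:
  assumes q: "q \<in> Hom C Y X" and s: "s \<in> Hom C X Y" and qs: "q \<cdot> s = Ident C X"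
    and u: "u \<in> Hom C V X" and v: "v \<in> Hom C V X" and eq: "s \<cdot> u = s \<cdot> v"
  shows "u = v"
proof -
  have "u = q \<cdot> s \<cdot> u" using Comp_assoc[OF u s q] qs Comp_Ident_left[OF u] by simp
  also have "\<dots> = q \<cdot> s \<cdot> v" using eq by simp
  also have "\<dots> = v" using Comp_assoc[OF v s q] qs Comp_Ident_left[OF v] by simp
  finally show ?thesis .
qed

text \<open>Passing from parallel arrows \<open>f, g : S \<rightarrow> Y\<close> to sections of \<open>S \<times> Y \<rightarrow> S\<close> makes the
  two arrows usable as constants over \<open>S\<close>.\<close>

lemma distinct_sections:
  assumes f: "f \<in> Hom C S Y" and g: "g \<in> Hom C S Y" and "f \<noteq> g"
  obtains Z p a b where "p \<in> Hom C Z S" "a \<in> Hom C S Z" "b \<in> Hom C S Z"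
    "p \<cdot> a = Ident C S" "p \<cdot> b = Ident C S" "a \<noteq> b"
proof -
  define X where "X i = (if i = (0::nat) then S else Y)" for i
  note S = Hom_Obj(1)[OF f]
  obtain Z \<pi> where Z: "jointly_monic C {0, 1} X Z \<pi>"
    and lift: "\<And>S g. S \<in> Obj C \<Longrightarrow> (\<And>i. i \<in> {0, 1} \<Longrightarrow> g i \<in> Hom C S (X i)) \<Longrightarrow>
       \<exists>u \<in> Hom C S Z. \<forall>i\<in>{0, 1}. \<pi> i \<cdot> u = g i"
    by (rule ex_product[of "{0, 1}" X]) (use Hom_Obj[OF f] X_def in auto)
  \<comment> \<open>The sections are the graphs of the arrows \<open>h\<close>; those of
    \<open>f\<close> and \<open>g\<close> differ in the second component.\<close>
  have "\<exists>u \<in> Hom C S Z. \<pi> 0 \<cdot> u = Ident C S \<and> \<pi> 1 \<cdot> u = h" if "h \<in> Hom C S Y" for h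
    using lift[OF S, of "\<lambda>i. if i = 0 then Ident C S else h"] Ident_in_Hom[OF S] that
    by (simp add: X_def)
  then obtain a b where "a \<in> Hom C S Z" "\<pi> 0 \<cdot> a = Ident C S" "\<pi> 1 \<cdot> a = f"
    "b \<in> Hom C S Z" "\<pi> 0 \<cdot> b = Ident C S" "\<pi> 1 \<cdot> b = g"
    using f g by metis
  moreover have "\<pi> 0 \<in> Hom C Z S"
    using Z unfolding jointly_monic_def X_def by simp
  ultimately show thesis using that assms(3) by metis
qed

section \<open>Conditions that closed relations impose on a matrix, tested on two distinct
  sections\<close>

context
  fixes n m k :: nat and M :: "nat mat" and S Z p a b
  assumes M: "M \<in> matr n m k" and cl: "has_closed_relations C n m k M"
    and p: "p \<in> Hom C Z S" and a: "a \<in> Hom C S Z" and b: "b \<in> Hom C S Z"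
    and pa: "p \<cdot> a = Ident C S" and pb: "p \<cdot> b = Ident C S" and ab: "a \<noteq> b"
begin

text \<open>If the right entry were new, reading it as \<open>b\<close> and every other variable as
  \<open>a\<close> in this row would put all left columns, but not the right one, into the relation
  that the section \<open>a\<close> defines.\<close>

lemma right_entry_in_row:
  assumes i: "i < n"
  shows "\<exists>l<m. M $$ (i, l) = M $$ (i, m)"
proof (rule ccontr)
  assume none: "\<not> ?thesis"
  note S = Hom_Obj(1)[OF a]
  note idS = Ident_in_Hom[OF S]
  \<comment> \<open>The other rows carry \<open>S\<close>, which is terminal over \<open>S\<close>,
    so over \<open>S\<close> only row \<open>i\<close> is constrained.\<close>
  define X where "X t = (if t = i then Z else S)" for t
  define r where "r t = (if t = i then a else Ident C S)" for t
  define f where "f t x = (if t = i then if x = M $$ (i, m) then b else a else Ident C S)" for t x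
  have "jointly_monic C {..<n} X S r"
    unfolding jointly_monic_def
  proof (intro conjI ballI impI S)
    show "r t \<in> Hom C S (X t)" for t unfolding r_def X_def using a idS by simp
    fix V u v
    assume uv: "u \<in> Hom C V S" "v \<in> Hom C V S" and eq: "\<forall>t\<in>{..<n}. r t \<cdot> u = r t \<cdot> v"
    have "a \<cdot> u = a \<cdot> v" using eq i unfolding r_def by force
    then show "u = v" by (rule section_monic[OF p a pa uv])
  qed
  note r = this
  have "\<exists>z \<in> Hom C S S. \<forall>t<n. r t \<cdot> z = f t (M $$ (t, m))"
  proof (rule closed_relations_span[OF cl matr_entry[OF M] r S])
    show "f t \<in> {1..k} \<rightarrow> Hom C S (X t)" for t
      using a b idS by (simp add: f_def X_def)
    show "\<exists>z \<in> Hom C S S. \<forall>t<n. r t \<cdot> z = f t (M $$ (t, l))" if "l < m" for l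
      using none that idS by (intro bexI[of _ "Ident C S"])
        (auto simp: f_def r_def Comp_Ident_right[OF a] Comp_Ident_right[OF idS])
  qed
  then obtain z where z: "z \<in> Hom C S S" "r i \<cdot> z = f i (M $$ (i, m))"
    using i by blast
  then have "a \<cdot> z = b" unfolding r_def f_def by simp
  \<comment> \<open>Composing with \<open>p\<close> forces this also when \<open>i\<close> is the
    only row.\<close>
  then have "z = Ident C S"
    using Comp_assoc[OF z(1) a p] pa pb Comp_Ident_left[OF z(1)] by metis
  then show False
    using \<open>a \<cdot> z = b\<close> Comp_Ident_right[OF a] ab by simp
qed

text \<open>If the right entries of two rows were not connected, colouring the components by \<open>a\<close> and
  \<open>b\<close> would give left columns on the diagonal of \<open>Z \<times> Z\<close> and a right column off it.\<close>

lemma right_entries_connected: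
  assumes i: "i < n" and j: "j < n" and ij: "i \<noteq> j"
  shows "difunctional_closure (row_pairs m M i j) (M $$ (i, m)) (M $$ (j, m))"
    (is "?D (M $$ (i, m)) (M $$ (j, m))")
proof (rule ccontr)
  assume none: "\<not> ?thesis"
  note S = Hom_Obj(1)[OF a] and Z = Hom_Obj(2)[OF a]
  note idS = Ident_in_Hom[OF S] and idZ = Ident_in_Hom[OF Z]
  \<comment> \<open>\<open>Z\<close> is embedded diagonally in rows \<open>i\<close> and
    \<open>j\<close>; the remaining rows record only the projection to \<open>S\<close>.\<close>
  define X where "X t = (if t = i \<or> t = j then Z else S)" for t
  define r where "r t = (if t = i \<or> t = j then Ident C Z else p)" for t
  \<comment> \<open>In both rows \<open>a\<close> marks the component of the right entry of row
    \<open>j\<close>. A value of row \<open>j\<close> is recognised by a neighbour \<open>x'\<close>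
    from row \<open>i\<close>, since the closure relates only values of row \<open>i\<close> to
    values of row \<open>j\<close>.\<close>
  define f where "f t x = (if t = i then if ?D x (M $$ (j, m)) then a else b
    else if t = j then if \<exists>x'. ?D x' (M $$ (j, m)) \<and> ?D x' x then a else b
    else Ident C S)" for t x
  have ends: "f i (M $$ (i, l)) = f j (M $$ (j, l))" if "l < m" for l
  proof -
    have D: "?D (M $$ (i, l)) (M $$ (j, l))"
      by (rule difunctional_closure.base) (use that in blast)
    have "(\<exists>x'. ?D x' (M $$ (j, m)) \<and> ?D x' (M $$ (j, l))) \<longleftrightarrow> ?D (M $$ (i, l)) (M $$ (j, m))"
    proof
      assume "\<exists>x'. ?D x' (M $$ (j, m)) \<and> ?D x' (M $$ (j, l))"
      then obtain x' where "?D x' (M $$ (j, m))" "?D x' (M $$ (j, l))" by blast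
      then show "?D (M $$ (i, l)) (M $$ (j, m))" by (intro difunctional_closure.step[OF D])
    qed (use D in blast)
    then show ?thesis using ij unfolding f_def by simp
  qed
  \<comment> \<open>The right entry of row \<open>j\<close> needs a partner in row \<open>i\<close>
    to receive the colour \<open>a\<close>; a left column containing it provides one.\<close>
  obtain l where l: "l < m" "M $$ (j, l) = M $$ (j, m)" using right_entry_in_row[OF j] by blast
  have "?D (M $$ (i, l)) (M $$ (j, m))"
    by (rule difunctional_closure.base) (use l in \<open>auto intro!: exI[of _ l]\<close>)
  then have right: "f i (M $$ (i, m)) = b" "f j (M $$ (j, m)) = a"
    using none ij unfolding f_def by auto
  have "jointly_monic C {..<n} X Z r"
    unfolding jointly_monic_def
  proof (intro conjI ballI impI Z)
    show "r t \<in> Hom C Z (X t)" for t unfolding r_def X_def using p idZ by simp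
    fix V u v
    assume uv: "u \<in> Hom C V Z" "v \<in> Hom C V Z" and eq: "\<forall>t\<in>{..<n}. r t \<cdot> u = r t \<cdot> v"
    have "Ident C Z \<cdot> u = Ident C Z \<cdot> v" using eq i unfolding r_def by force
    then show "u = v" using Comp_Ident_left uv by metis
  qed
  note r = this
  have "\<exists>z \<in> Hom C S Z. \<forall>t<n. r t \<cdot> z = f t (M $$ (t, m))"
  proof (rule closed_relations_span[OF cl matr_entry[OF M] r S])
    show "f t \<in> {1..k} \<rightarrow> Hom C S (X t)" for t
      using a b idS by (simp add: f_def X_def)
    show "\<exists>z \<in> Hom C S Z. \<forall>t<n. r t \<cdot> z = f t (M $$ (t, l))" if l: "l < m" for l
    proof (intro bexI allI impI)
      show z: "f i (M $$ (i, l)) \<in> Hom C S Z" unfolding f_def using a b by simp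
      have "p \<cdot> f i (M $$ (i, l)) = Ident C S" unfolding f_def using pa pb by simp
      then have "r t \<cdot> f i (M $$ (i, l)) = (if t = i \<or> t = j then f i (M $$ (i, l)) else Ident C S)" for t
        unfolding r_def using Comp_Ident_left[OF z] by simp
      moreover have "f t x = Ident C S" if "t \<noteq> i" "t \<noteq> j" for t x
        unfolding f_def using that by simp
      ultimately show "r t \<cdot> f i (M $$ (i, l)) = f t (M $$ (t, l))" for t
        using ends[OF l] by auto
    qed
  qed
  then obtain z where z: "z \<in> Hom C S Z" "\<forall>t<n. r t \<cdot> z = f t (M $$ (t, m))"
    by blast
  then have "r i \<cdot> z = b" "r j \<cdot> z = a" using i j right by auto
  then show False unfolding r_def using ab by simp
qed

end

end

section \<open>Sufficiency of the two combinatorial conditions\<close>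

context regular_arithmetical_cat
begin

text \<open>Connectedness puts every pair of right entries locally into \<open>W\<close>;
  Baker--Pixley combines the pairs, and joint monicity of the whole family removes the
  cover.\<close>

lemma closed_relations_of_connected:
  assumes M: "M \<in> matr n m k"
    and entry: "\<And>i. i < n \<Longrightarrow> \<exists>l<m. M $$ (i, l) = M $$ (i, m)"
    and conn: "\<And>i j. i < n \<Longrightarrow> j < n \<Longrightarrow> i \<noteq> j \<Longrightarrow>
      difunctional_closure (row_pairs m M i j) (M $$ (i, m)) (M $$ (j, m))"
  shows "has_closed_relations C n m k M"
proof (rule closed_relationsI[OF matr_entry[OF M]])
  fix X W r S f
  assume r: "jointly_monic C {..<n} X W r" and S: "S \<in> Obj C"
    and f: "\<And>i. i < n \<Longrightarrow> f i \<in> {1..k} \<rightarrow> Hom C S (X i)"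
    and left: "\<And>l. l < m \<Longrightarrow> \<exists>z \<in> Hom C S W. \<forall>i<n. r i \<cdot> z = f i (M $$ (i, l))"
  define y where "y i = f i (M $$ (i, m))" for i
  have W: "W \<in> Obj C" and rH: "\<And>i. i < n \<Longrightarrow> r i \<in> Hom C W (X i)"
    using r unfolding jointly_monic_def by auto
  have y: "y i \<in> Hom C S (X i)" if "i < n" for i
    unfolding y_def using f[OF that] matr_entry[OF M that] by blast
  have pair: "\<exists>T e z. cover T S e \<and> z \<in> Hom C T W \<and> r i \<cdot> z = y i \<cdot> e \<and> r j \<cdot> z = y j \<cdot> e"
    if i: "i < n" and j: "j < n" for i j
  proof (cases "i = j")
    case True
    obtain l where "l < m" "M $$ (i, l) = M $$ (i, m)" using entry[OF i] by blast
    then obtain z where "z \<in> Hom C S W" "r i \<cdot> z = y i"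
      using left i unfolding y_def by metis
    then show ?thesis
      using True cover.Ident[OF S] Comp_Ident_right[OF y[OF i]] by metis
  next
    case False
    \<comment> \<open>The two components alone need not be jointly monic, so difunctionality is
      applied to the binary image.\<close>
    obtain E e g where E: "cover W E e" "jointly_monic C {i, j} X E g"
      "\<forall>t\<in>{i, j}. g t \<cdot> e = r t"
      by (rule image_factorisation[of "{i, j}" W r X]) (use W rH i j in auto)
    note eH = cover_Hom[OF E(1)]
    have gH: "g t \<in> Hom C E (X t)" if "t \<in> {i, j}" for t
      using E(2) that unfolding jointly_monic_def by blast
    have ge: "g t \<cdot> e \<cdot> u = r t \<cdot> u" if "u \<in> Hom C V W" "t \<in> {i, j}" for u V t
      using Comp_assoc[OF that(1) eH gH[OF that(2)]] bspec[OF E(3) that(2)] by simp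
    \<comment> \<open>Proved for all pairs in the closure by induction: edges come from left
      columns, and each closure step is an instance of difunctionality.\<close>
    have "\<exists>u \<in> Hom C S E. g i \<cdot> u = f i x \<and> g j \<cdot> u = f j w"
      if "difunctional_closure (row_pairs m M i j) x w" for x w
      using that
    proof induction
      case (base x w)
      then obtain l where l: "l < m" "x = M $$ (i, l)" "w = M $$ (j, l)" by blast
      obtain z where "z \<in> Hom C S W" "\<forall>t<n. r t \<cdot> z = f t (M $$ (t, l))"
        using left[OF l(1)] by blast
      then show ?case
        using ge[of z S] Comp_in_Hom[OF _ eH] i j l(2,3) by (intro bexI[of _ "e \<cdot> z"]) auto
    next
      case (step x w' x' w)
      then obtain z0 z1 z2 where z: "z0 \<in> Hom C S E" "z1 \<in> Hom C S E" "z2 \<in> Hom C S E"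
        and eq: "g i \<cdot> z0 = f i x" "g j \<cdot> z0 = f j w'" "g i \<cdot> z1 = f i x'" "g j \<cdot> z1 = f j w'"
          "g i \<cdot> z2 = f i x'" "g j \<cdot> z2 = f j w"
        by blast
      have "\<exists>u \<in> Hom C S E. \<forall>t\<in>{i, j}. g t \<cdot> u = (if t = i then f i x else f j w)"
        by (rule difunctional_family[OF _ E(2) z]) (use eq in auto)
      then show ?case using False by auto
    qed
    from this[OF conn[OF i j False]]
    obtain u where u: "u \<in> Hom C S E" "g i \<cdot> u = y i" "g j \<cdot> u = y j"
      unfolding y_def by blast
    obtain T d z where T: "cover T S d" "z \<in> Hom C T W" "e \<cdot> z = u \<cdot> d"
      using cover_lift[OF E(1) u(1)] by blast
    have "r t \<cdot> z = (g t \<cdot> u) \<cdot> d" if "t \<in> {i, j}" for t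
      using ge[OF T(2) that] T(3) Comp_assoc[OF cover_Hom[OF T(1)] u(1) gH[OF that]] by simp
    from this[of i] this[of j] show ?thesis using T(1,2) u(2,3) by auto
  qed
  have "\<exists>T e z. cover T S e \<and> z \<in> Hom C T W \<and> (\<forall>i\<in>{..<n}. r i \<cdot> z = y i \<cdot> e)"
    by (rule two_decomposable[OF W, of "{..<n}" y S X r])
      (use y pair rH M in \<open>auto simp: matr_def\<close>)
  then obtain T e z where T: "cover T S e" "z \<in> Hom C T W" "\<forall>i\<in>{..<n}. r i \<cdot> z = y i \<cdot> e"
    by blast
  have "\<exists>w \<in> Hom C S W. \<forall>i\<in>{..<n}. r i \<cdot> w = y i"
    by (rule cover_diagonal[OF T(1) r T(2)]) (use y T(3) in auto)
  then show "\<exists>w \<in> Hom C S W. \<forall>i<n. r i \<cdot> w = f i (M $$ (i, m))"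
    unfolding y_def by auto
qed

end

theorem theorem3p4:
  fixes n m k :: nat and M :: "nat mat" and C :: "('o, 'a) cat"
  assumes "M \<in> matr n m k"
    and "\<not> trivial_matrix TYPE(('p, 'b) cat) n m k M"
    and "regular_category C"
    and "arithmetical C"
  shows "has_closed_relations C n m k M"
proof -
  obtain D :: "('p, 'b) cat" where D: "finitely_complete D" "has_closed_relations D n m k M"
    and np: "\<not> preorder_category D"
    using assms(2) unfolding trivial_matrix_def by blast
  interpret D: finitely_complete_category D
    by (rule finitely_complete_categoryI[OF D(1)])
  obtain S Y f g where "f \<in> Hom D S Y" "g \<in> Hom D S Y" "f \<noteq> g"
    using np D.category_axioms unfolding preorder_category_def by blast
  then obtain Z p a b where sec: "p \<in> Hom D Z S" "a \<in> Hom D S Z" "b \<in> Hom D S Z"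
    "Comp D p a = Ident D S" "Comp D p b = Ident D S" "a \<noteq> b"
    by (rule D.distinct_sections)
  interpret C: regular_arithmetical_cat C
  proof -
    interpret C: finitely_complete_category C
      using assms(4) finitely_complete_categoryI unfolding arithmetical_def by blast
    show "regular_arithmetical_cat C"
      by unfold_locales (use assms(3,4) in \<open>simp_all add: arithmetical_def\<close>)
  qed
  \<comment> \<open>The two conditions are combinatorial statements about \<open>M\<close> alone, so
    they carry over from \<open>D\<close>, where they were forced, to \<open>C\<close>, where they
    suffice.\<close>
  show ?thesis
    using C.closed_relations_of_connected[OF assms(1)]
      D.right_entry_in_row[OF assms(1) D(2) sec] D.right_entries_connected[OF assms(1) D(2) sec]
    by blast
qed

end
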